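(* Let $k'\in\mathcal{K}_\omega$ and $k\in\mathrm{conj}(k')$. Let $f\in L^1([a,b];\mathbb{R})$ be such that $I_b^{k'}f$ has an absolutely continuous representative. Then $$I_b^k \left(D_b^{k'}f\right)(x)=f(x)+(I_b^{k'}f)(b)\, \left(\frac{1}{\omega(x)}\frac{d}{dx}\right)\delta_{\mathbf{1},k}(b,x),\quad \text{a.e. } x\in[a,b].$$
   Context: Let $a<b$ be real numbers, $\mathbb{R}_+=(0,+\infty)$, and $\Omega=\{(x,y)\in[a,b]\times[a,b] : x>y\}$. Fix a weight function $\omega:[a,b]\to\mathbb{R}_+$ such that $\omega,\omega^{-1}\in L^\infty([a,b];\mathbb{R})$, where $\omega^{-1}=1/\omega$. For a (measurable) kernel-function $k:\Omega\to\mathbb{R}_+$ put $F_k(y)=\int_y^b k(x,y)\omega(x)\,dx$ for $y\in[a,b)$ and $G_k(y)=\int_a^y k(y,x)\omega(x)\,dx$ for $y\in(a,b]$. Let $\mathcal{K}_\omega$ be the set of measurable $k:\Omega\to\mathbb{R}_+$ such that $F_k\in L^\infty([a,b);\mathbb{R})$ and $G_k\in L^\infty((a,b];\mathbb{R})$. For $k_1,k_2\in\mathcal{K}_\omega$ put $\delta_{k_1,k_2}(x,y)=\int_y^x k_1(x,z)k_2(z,y)\omega(z)\,dz$ for $(x,y)\in\Omega$. Kernels $k,k'\in\mathcal{K}_\omega$ are conjugate if $\delta_{k,k'}(x,y)=\delta_{k',k}(x,y)=1$ for all $(x,y)\in\Omega$; $\mathrm{conj}(k')$ is the set of $k\in\mathcal{K}_\omega$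 such that $k$ and $k'$ are conjugate. $\mathbf{1}\in\mathcal{K}_\omega$ is the unit kernel, $\mathbf{1}(x,y)=1$ for $(x,y)\in\Omega$; so $\delta_{\mathbf{1},k}(b,x)=\int_x^b k(z,x)\omega(z)\,dz$. For $k\in\mathcal{K}_\omega$ and $f\in L^1([a,b];\mathbb{R})$ the right-sided $k$-integral is $(I_b^kf)(x)=\int_x^b k(y,x)f(y)\omega(y)\,dy$ for a.e. $x\in[a,b]$. A function in $L^1([a,b];\mathbb{R})$ has an absolutely continuous representative if it agrees a.e. with an absolutely continuous function on $[a,b]$, with which it is then identified; in particular $(I_b^{k'}f)(b)$ denotes the value at $b$ of the absolutely continuous representative of $I_b^{k'}f$. If $f\in L^1([a,b];\mathbb{R})$ and $I_b^{k'}f$ has an absolutely continuous representative, the right-sided $k'$-derivative of $f$ is $(D_b^{k'}f)(x)=-\frac{1}{\omega(x)}\frac{d}{dx}(I_b^{k'}f)(x)$ for a.e. $x\in[a,b]$. *)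

theory Defs
  imports "HOL-Analysis.Analysis"
begin

(* Functions on a subset of the reals (or of the plane) are represented by total functions of which
   only the values on that subset are used.  "Measurable", "almost everywhere" and all integrals
   refer to Lebesgue measure; real integrals are Bochner integrals, which are 0 when the integrand
   is not integrable. *)

definition Linfty :: "'a measure \<Rightarrow> ('a \<Rightarrow> real) \<Rightarrow> bool" where
  "Linfty M f \<longleftrightarrow> f \<in> borel_measurable M \<and> (\<exists>C. AE x in M. \<bar>f x\<bar> \<le> C)"

definition weight :: "real \<Rightarrow> real \<Rightarrow> (real \<Rightarrow> real) \<Rightarrow> bool" where
  "weight a b \<omega> \<longleftrightarrow> (\<forall>x\<in>{a..b}. \<omega> x > 0) \<and>
     Linfty (lebesgue_on {a..b}) \<omega> \<and> Linfty (lebesgue_on {a..b}) (\<lambda>x. 1 / \<omega> x)"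

definition Omega :: "real \<Rightarrow> real \<Rightarrow> (real \<times> real) set" where
  "Omega a b = {(x, y). x \<in> {a..b} \<and> y \<in> {a..b} \<and> x > y}"

(* The integration ranges below are open at every end where the integrand would lie on the
   diagonal, which does not belong to Omega; this changes the ranges only by null sets. *)

definition F_int :: "real \<Rightarrow> (real \<Rightarrow> real) \<Rightarrow> (real \<Rightarrow> real \<Rightarrow> real) \<Rightarrow> real \<Rightarrow> real" where
  "F_int b \<omega> k y = (LINT x|lebesgue_on {y<..b}. k x y * \<omega> x)"

definition G_int :: "real \<Rightarrow> (real \<Rightarrow> real) \<Rightarrow> (real \<Rightarrow> real \<Rightarrow> real) \<Rightarrow> real \<Rightarrow> real" where
  "G_int a \<omega> k y = (LINT x|lebesgue_on {a..<y}. k y x * \<omega> x)"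

(* The two integrability conditions say that the integrals of positive functions defining F_k and
   G_k are finite almost everywhere; this is part of F_k and G_k being essentially bounded, but is
   not visible in F_int and G_int because a divergent Bochner integral has the value 0. *)

definition kernels :: "real \<Rightarrow> real \<Rightarrow> (real \<Rightarrow> real) \<Rightarrow> (real \<Rightarrow> real \<Rightarrow> real) set" where
  "kernels a b \<omega> = {k.
     (\<lambda>(x, y). k x y) \<in> borel_measurable (lebesgue_on (Omega a b)) \<and>
     (\<forall>(x, y)\<in>Omega a b. k x y > 0) \<and>
     (AE y in lebesgue_on {a..<b}. integrable (lebesgue_on {y<..b}) (\<lambda>x. k x y * \<omega> x)) \<and>
     Linfty (lebesgue_on {a..<b}) (F_int b \<omega> k) \<and>
     (AE y in lebesgue_on {a<..b}. integrable (lebesgue_on {a..<y}) (\<lambda>x. k y x * \<omega> x)) \<and>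
     Linfty (lebesgue_on {a<..b}) (G_int a \<omega> k)}"

definition delta ::
  "(real \<Rightarrow> real) \<Rightarrow> (real \<Rightarrow> real \<Rightarrow> real) \<Rightarrow> (real \<Rightarrow> real \<Rightarrow> real) \<Rightarrow> real \<Rightarrow> real \<Rightarrow> real" where
  "delta \<omega> k1 k2 x y = (LINT z|lebesgue_on {y<..<x}. k1 x z * k2 z y * \<omega> z)"

definition conjugate ::
  "real \<Rightarrow> real \<Rightarrow> (real \<Rightarrow> real) \<Rightarrow> (real \<Rightarrow> real \<Rightarrow> real) \<Rightarrow> (real \<Rightarrow> real \<Rightarrow> real) \<Rightarrow> bool" where
  "conjugate a b \<omega> k k' \<longleftrightarrow> k \<in> kernels a b \<omega> \<and> k' \<in> kernels a b \<omega> \<and>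
     (\<forall>(x, y)\<in>Omega a b. delta \<omega> k k' x y = 1 \<and> delta \<omega> k' k x y = 1)"

definition conj_kernels ::
  "real \<Rightarrow> real \<Rightarrow> (real \<Rightarrow> real) \<Rightarrow> (real \<Rightarrow> real \<Rightarrow> real) \<Rightarrow> (real \<Rightarrow> real \<Rightarrow> real) set" where
  "conj_kernels a b \<omega> k' = {k \<in> kernels a b \<omega>. conjugate a b \<omega> k k'}"

definition unit_kernel :: "real \<Rightarrow> real \<Rightarrow> real" where
  "unit_kernel x y = 1"

definition right_integral ::
  "real \<Rightarrow> (real \<Rightarrow> real) \<Rightarrow> (real \<Rightarrow> real \<Rightarrow> real) \<Rightarrow> (real \<Rightarrow> real) \<Rightarrow> real \<Rightarrow> real" where
  "right_integral b \<omega> k f x = (LINT y|lebesgue_on {x<..b}. k y x * f y * \<omega> y)"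

(* The usual epsilon-delta definition: the n pairwise disjoint subintervals are (s i, t i), i < n. *)

definition abs_cont_on :: "real \<Rightarrow> real \<Rightarrow> (real \<Rightarrow> real) \<Rightarrow> bool" where
  "abs_cont_on a b g \<longleftrightarrow> (\<forall>\<epsilon>>0. \<exists>\<delta>>0. \<forall>(n::nat) s t.
     (\<forall>i<n. a \<le> s i \<and> s i < t i \<and> t i \<le> b) \<longrightarrow>
     disjoint_family_on (\<lambda>i. {s i<..<t i}) {..<n} \<longrightarrow>
     (\<Sum>i<n. t i - s i) < \<delta> \<longrightarrow> (\<Sum>i<n. \<bar>g (t i) - g (s i)\<bar>) < \<epsilon>)"

definition is_ac_rep :: "real \<Rightarrow> real \<Rightarrow> (real \<Rightarrow> real) \<Rightarrow> (real \<Rightarrow> real) \<Rightarrow> bool" where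
  "is_ac_rep a b u g \<longleftrightarrow> abs_cont_on a b g \<and> (AE x in lebesgue_on {a..b}. u x = g x)"

definition has_ac_rep :: "real \<Rightarrow> real \<Rightarrow> (real \<Rightarrow> real) \<Rightarrow> bool" where
  "has_ac_rep a b u \<longleftrightarrow> (\<exists>g. is_ac_rep a b u g)"

(* For a < b any two absolutely continuous representatives agree on all of [a, b], so the choice
   made here affects only values outside [a, b]. *)

definition ac_rep :: "real \<Rightarrow> real \<Rightarrow> (real \<Rightarrow> real) \<Rightarrow> real \<Rightarrow> real" where
  "ac_rep a b u = (SOME g. is_ac_rep a b u g)"

definition right_derivative ::
  "real \<Rightarrow> real \<Rightarrow> (real \<Rightarrow> real) \<Rightarrow> (real \<Rightarrow> real \<Rightarrow> real) \<Rightarrow> (real \<Rightarrow> real) \<Rightarrow> real \<Rightarrow> real" where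
  "right_derivative a b \<omega> k f x = - (1 / \<omega> x) * deriv (ac_rep a b (right_integral b \<omega> k f)) x"

end

(* Write K f for the right-sided k-integral, K' f for the k'-integral and W f for the integral of
   f w over the tail (x, b]. Conjugacy says that K K' = K' K = W. Let g be the absolutely continuous
   representative of K' f, so that the derivative D f satisfies W (D f) = g - g(b). Then
   W K (D f) = K W (D f) = K K' f - g(b) K 1 = W f - g(b) K 1, where W K = K K' K = K W by Tonelli's
   theorem. The same identity of kernels gives, at every point, that (K 1)(y) is the integral of
   k(b, z) w(z) over (y, b], so that delta_{1,k}(b, y) is differentiable almost everywhere with
   derivative -k(b, y) w(y), and differentiating the displayed identity gives the claim. *)
theory Submission
  imports Defs
begin

text \<open>Most hypotheses on a kernel hold up to null sets, whereas the claim involves single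
  sections. The derivative of \<open>delta \<omega> unit_kernel k b\<close> is governed by
  \<open>k b\<close>, which lives on a line, a null set of the plane, so neither Fubini nor the
  essential bound on \<open>G_int\<close> controls it. Conjugacy and positivity are the hypotheses
  that hold at every point of \<open>Omega\<close>. A Bochner integral with value 1 is not the
  default 0, so each instance of conjugacy also says that its integrand is measurable and
  integrable. Division then makes the sections of \<open>k\<close> measurable, and Fatou's lemma
  with the bound on \<open>F_int\<close> makes \<open>k b\<close> integrable. The functions compared
  at the end are merely integrable, so their equality is read off from tail integrals. This step,
  the derivative of \<open>delta\<close> and the derivative of the absolutely continuous
  representative all rest on the Lebesgue differentiation theorem. For the representative it must
  first be known that an absolutely continuous function is an indefinite integral; this comes from
  Radon-Nikodym after a decomposition into monotone functions.\<close>

section \<open>The Lebesgue differentiation theorem\<close>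

text \<open>By the Henstock lemma, disjoint bad intervals that are fine for a suitable gauge have
  arbitrarily small total length; the Vitali covering lemma transfers this to the set of tags.\<close>

lemma negligible_bad_tagged_intervals:
  fixes h :: "real \<Rightarrow> real"
  assumes h: "h integrable_on {a..b}" and c: "c > 0"
  shows "negligible {x \<in> {a..b}. \<forall>d>0. \<exists>u v. a \<le> u \<and> u < v \<and> v \<le> b \<and> x \<in> {u..v} \<and> v - u < d \<and>
            \<bar>h x * (v - u) - integral {u..v} h\<bar> > c * (v - u)}" (is "negligible ?S")
proof -
  define B where "B = ?S"
  have "negligible B"
    unfolding negligible_outer_le
  proof (intro allI impI)
    fix e :: real assume "e > 0"
    \<comment> \<open>The Vitali lemma enlarges radii by the factor 5, and a ball of radius
      \<open>5 * r x\<close> has length \<open>10 * r x\<close>. The factor \<open>c\<close> is the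
      rate at which each bad interval contributes to the Henstock sum.\<close>
    then have e': "c * e / 10 > 0" using c by simp
    obtain \<gamma> where \<gamma>: "gauge \<gamma>" and fine: "\<And>p. \<lbrakk>p tagged_partial_division_of (cbox a b); \<gamma> fine p\<rbrakk> \<Longrightarrow>
               sum (\<lambda>(x,k). norm(measure lborel k *\<^sub>R h x - integral k h)) p < c * e / 10"
      using Henstock_lemma[of h a b, OF _ e'] h by auto
    have "\<forall>x\<in>B. \<exists>u v. a \<le> u \<and> u < v \<and> v \<le> b \<and> x \<in> {u..v} \<and> v - u \<le> 1 \<and> {u..v} \<subseteq> \<gamma> x \<and>
              \<bar>h x * (v - u) - integral {u..v} h\<bar> > c * (v - u)"
    proof
      fix x assume x: "x \<in> B"
      have "open (\<gamma> x)" "x \<in> \<gamma> x" using \<gamma> by (auto simp: gauge_def)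
      then obtain d where d: "d > 0" "ball x d \<subseteq> \<gamma> x" by (meson open_contains_ball)
      \<comment> \<open>The cap 1 on the length provides the bounded radii that the Vitali lemma
        asks for.\<close>
      have "min d 1 > 0" using d by auto
      then obtain u v where uv: "a \<le> u" "u < v" "v \<le> b" "x \<in> {u..v}" "v - u < min d 1"
        "\<bar>h x * (v - u) - integral {u..v} h\<bar> > c * (v - u)"
        using x unfolding B_def by blast
      have "{u..v} \<subseteq> ball x d" using uv by (auto simp: dist_real_def)
      with d uv show "\<exists>u v. a \<le> u \<and> u < v \<and> v \<le> b \<and> x \<in> {u..v} \<and> v - u \<le> 1 \<and> {u..v} \<subseteq> \<gamma> x \<and>
              \<bar>h x * (v - u) - integral {u..v} h\<bar> > c * (v - u)"
        by (intro exI[of _ u] exI[of _ v]) auto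
    qed
    then obtain u v where uv: "\<And>x. x \<in> B \<Longrightarrow> a \<le> u x \<and> u x < v x \<and> v x \<le> b \<and> x \<in> {u x..v x} \<and> v x - u x \<le> 1 \<and>
       {u x..v x} \<subseteq> \<gamma> x \<and> \<bar>h x * (v x - u x) - integral {u x..v x} h\<bar> > c * (v x - u x)"
      unfolding bchoice_iff by blast
    \<comment> \<open>The full length serves as radius because the tag \<open>x\<close> may lie
      anywhere in its interval; the ball around \<open>x\<close> then contains the interval, and
      disjoint balls give non-overlapping intervals.\<close>
    define r where "r x = v x - u x" for x
    have r: "0 < r x \<and> r x \<le> 1" if "x \<in> B" for x
      using uv[OF that] by (auto simp: r_def)
    have cov: "B \<subseteq> (\<Union>x\<in>B. cball x (r x))" using r by force
    obtain C where C: "countable C" "C \<subseteq> B"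
       "pairwise (\<lambda>i j. disjnt (cball i (r i)) (cball j (r j))) C"
       "B \<subseteq> (\<Union>i\<in>C. cball i (5 * r i))"
      by (rule Vitali_covering_lemma_cballs[OF cov r])
    have sumF: "(\<Sum>x\<in>F. r x) \<le> e / 10" if F: "F \<subseteq> C" "finite F" for F
    proof -
      let ?p = "(\<lambda>x. (x, {u x..v x})) ` F"
      have sub: "{u x..v x} \<subseteq> cball x (r x)" if "x \<in> F" for x
        using uv[of x] subsetD[OF C(2), of x] subsetD[OF F(1) that] by (auto simp: r_def dist_real_def)
      have "?p tagged_partial_division_of (cbox a b)"
        unfolding tagged_partial_division_of_def
      proof (intro conjI)
        show "finite ?p" using F by simp
        have "x \<in> {u x..v x} \<and> {u x..v x} \<subseteq> cbox a b" if "x \<in> F" for x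
          using uv[of x] subsetD[OF C(2), of x] subsetD[OF F(1) that] by auto
        then show "\<forall>x K. (x, K) \<in> ?p \<longrightarrow> x \<in> K \<and> K \<subseteq> cbox a b \<and> (\<exists>a b. K = cbox a b)"
          unfolding box_real(2)[symmetric] by blast
        have "interior {u x..v x} \<inter> interior {u y..v y} = {}" if "x \<in> F" "y \<in> F" "x \<noteq> y" for x y
        proof -
          have "disjnt (cball x (r x)) (cball y (r y))"
            using C(3) that F unfolding pairwise_def by blast
          then show ?thesis
            using sub[OF that(1)] sub[OF that(2)] interior_subset[of "{u x..v x}"] interior_subset[of "{u y..v y}"]
            unfolding disjnt_def by blast
        qed
        then show "\<forall>x1 K1 x2 K2. (x1, K1) \<in> ?p \<and> (x2, K2) \<in> ?p \<and> (x1, K1) \<noteq> (x2, K2) \<longrightarrow>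
            interior K1 \<inter> interior K2 = {}"
          by blast
      qed
      moreover have "\<gamma> fine ?p" using uv F C(2) unfolding fine_def by blast
      ultimately have "sum (\<lambda>(x,k). norm(measure lborel k *\<^sub>R h x - integral k h)) ?p < c * e / 10"
        by (rule fine)
      moreover have "sum (\<lambda>(x,k). norm(measure lborel k *\<^sub>R h x - integral k h)) ?p
        = (\<Sum>x\<in>F. \<bar>h x * r x - integral {u x..v x} h\<bar>)"
      proof (subst sum.reindex)
        show "inj_on (\<lambda>x. (x, {u x..v x})) F" by (auto simp: inj_on_def)
        show "sum ((\<lambda>(x, k). norm (measure lborel k *\<^sub>R h x - integral k h)) \<circ> (\<lambda>x. (x, {u x..v x}))) F
          = (\<Sum>x\<in>F. \<bar>h x * r x - integral {u x..v x} h\<bar>)"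
        proof (rule sum.cong[OF refl])
          fix x assume "x \<in> F"
          then have "x \<in> B" using F C(2) by auto
          from uv[OF this] show "((\<lambda>(x, k). norm (measure lborel k *\<^sub>R h x - integral k h)) \<circ> (\<lambda>x. (x, {u x..v x}))) x
             = \<bar>h x * r x - integral {u x..v x} h\<bar>" by (simp add: r_def mult.commute)
        qed
      qed
      moreover have "(\<Sum>x\<in>F. c * r x) \<le> (\<Sum>x\<in>F. \<bar>h x * r x - integral {u x..v x} h\<bar>)"
      proof (rule sum_mono)
        fix x assume "x \<in> F"
        then have "x \<in> B" using F C(2) by auto
        from uv[OF this] show "c * r x \<le> \<bar>h x * r x - integral {u x..v x} h\<bar>" by (auto simp: r_def)
      qed
      ultimately have "c * (\<Sum>x\<in>F. r x) \<le> c * (e / 10)" by (simp add: sum_distrib_left)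
      then show ?thesis using c by simp
    qed
    have bound: "measure lebesgue (\<Union>i\<in>F. cball i (5 * r i)) \<le> e" if F: "F \<subseteq> C" "finite F" for F
    proof -
      have "measure lebesgue (\<Union>i\<in>F. cball i (5 * r i)) \<le> (\<Sum>i\<in>F. measure lebesgue (cball i (5 * r i)))"
        by (rule measure_UNION_le[OF F(2)]) auto
      also have "\<dots> = (\<Sum>i\<in>F. 10 * r i)"
      proof (rule sum.cong[OF refl])
        fix x assume "x \<in> F"
        then have "x \<in> B" using F C(2) by auto
        from r[OF this] show "measure lebesgue (cball x (5 * r x)) = 10 * r x"
          by (simp add: cball_eq_atLeastAtMost)
      qed
      also have "\<dots> = 10 * (\<Sum>i\<in>F. r i)" by (simp add: sum_distrib_left)
      finally show ?thesis using sumF[OF F] by simp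
    qed
    show "\<exists>T. B \<subseteq> T \<and> T \<in> lmeasurable \<and> measure lebesgue T \<le> e"
    proof (intro exI conjI)
      show "B \<subseteq> (\<Union>i\<in>C. cball i (5 * r i))" by (rule C(4))
      show "(\<Union>i\<in>C. cball i (5 * r i)) \<in> lmeasurable"
        by (rule fmeasurable_UN_bound[OF C(1) _ bound]) auto
      show "measure lebesgue (\<Union>i\<in>C. cball i (5 * r i)) \<le> e"
        by (rule measure_UN_bound[OF C(1) _ bound]) auto
    qed
  qed
  then show ?thesis by (simp add: B_def)
qed

text \<open>A point outside all the sets \<open>B n\<close> has no short bad intervals at any rate
  \<open>1 / (n + 1)\<close>. Applied to intervals with \<open>x\<close> as an endpoint, this is
  convergence of the difference quotients to \<open>h x\<close>.\<close>

lemma negligible_not_integral_has_real_derivative: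
  fixes h :: "real \<Rightarrow> real"
  assumes h: "h integrable_on {a..b}"
  shows "negligible {x \<in> {a<..<b}. \<not> ((\<lambda>t. integral {a..t} h) has_real_derivative h x) (at x)}"
    (is "negligible ?N")
proof -
  define B where "B n = {x \<in> {a..b}. \<forall>d>0. \<exists>u v. a \<le> u \<and> u < v \<and> v \<le> b \<and> x \<in> {u..v} \<and> v - u < d \<and>
            \<bar>h x * (v - u) - integral {u..v} h\<bar> > inverse (real (Suc n)) * (v - u)}" for n
  have "negligible (\<Union>n. B n)"
    unfolding B_def by (intro negligible_Union_nat negligible_bad_tagged_intervals h) simp
  moreover have "?N \<subseteq> (\<Union>n. B n)"
  proof (rule subsetI, rule ccontr)
    fix x assume x: "x \<in> ?N" and n: "x \<notin> (\<Union>n. B n)"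
    have ab: "a < x" "x < b" using x by auto
    let ?H = "\<lambda>t. integral {a..t} h"
    have diff: "?H v - ?H u = integral {u..v} h" if "a \<le> u" "u \<le> v" "v \<le> b" for u v
    proof -
      have "h integrable_on {a..v}" by (rule integrable_on_subinterval[OF h]) (use that in auto)
      from Henstock_Kurzweil_Integration.integral_combine[OF that(1,2) this] show ?thesis by simp
    qed
    have "((\<lambda>t. (?H t - ?H x) / (t - x)) \<longlongrightarrow> h x) (at x)"
    proof (rule tendstoI)
      fix e :: real assume "e > 0"
      then obtain n where n': "inverse (real (Suc n)) < e" using reals_Archimedean by blast
      from n ab have "x \<notin> B n" "x \<in> {a..b}" by auto
      then obtain d where d: "d > 0" and dd: "\<And>u v. a \<le> u \<Longrightarrow> u < v \<Longrightarrow> v \<le> b \<Longrightarrow> x \<in> {u..v} \<Longrightarrow> v - u < d \<Longrightarrow>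
           \<bar>h x * (v - u) - integral {u..v} h\<bar> \<le> inverse (real (Suc n)) * (v - u)"
        unfolding B_def by (force simp: not_less)
      have "dist ((?H t - ?H x) / (t - x)) (h x) < e" if t: "t \<noteq> x" "dist t x < min d (min (x - a) (b - x))" for t
      proof -
        have "\<bar>h x * (t - x) - (?H t - ?H x)\<bar> \<le> inverse (real (Suc n)) * \<bar>t - x\<bar>"
        proof (cases "x < t")
          case True
          with t dd[of x t] diff[of x t] ab show ?thesis by (auto simp: dist_real_def)
        next
          case False
          with t have "t < x" by auto
          with t dd[of t x] diff[of t x] ab have "\<bar>h x * (x - t) - (?H x - ?H t)\<bar> \<le> inverse (real (Suc n)) * (x - t)"
            by (auto simp: dist_real_def)
          with \<open>t < x\<close> show ?thesis by (simp add: abs_if algebra_simps split: if_splits)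
        qed
        also have "\<dots> < e * \<bar>t - x\<bar>" using n' t by (intro mult_strict_right_mono) auto
        finally have *: "\<bar>h x * (t - x) - (?H t - ?H x)\<bar> < e * \<bar>t - x\<bar>" .
        have "(?H t - ?H x) / (t - x) * (t - x) = ?H t - ?H x" using t by simp
        then have "\<bar>(?H t - ?H x) / (t - x) - h x\<bar> * \<bar>t - x\<bar> = \<bar>(?H t - ?H x) - h x * (t - x)\<bar>"
          by (simp only: abs_mult[symmetric] left_diff_distrib)
        with * have "\<bar>(?H t - ?H x) / (t - x) - h x\<bar> * \<bar>t - x\<bar> < e * \<bar>t - x\<bar>" by (simp add: abs_minus_commute)
        then show ?thesis using t by (simp add: dist_real_def)
      qed
      then show "\<forall>\<^sub>F t in at x. dist ((?H t - ?H x) / (t - x)) (h x) < e"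
        unfolding eventually_at using d ab by (intro exI[of _ "min d (min (x - a) (b - x))"]) auto
    qed
    with x show False by (simp add: has_field_derivative_iff)
  qed
  ultimately show ?thesis by (rule negligible_subset)
qed

section \<open>Absolutely continuous functions are integrals\<close>

text \<open>Sets of pairs, in place of the indexed families of \<open>abs_cont_on\<close>, can be
  united, split and cut. Only the open intervals must lie in \<open>U\<close>, so endpoints may lie
  on its boundary.\<close>

definition interval_families :: "real set \<Rightarrow> (real \<times> real) set set" where
  "interval_families U = {D. finite D \<and> (\<forall>(s, t)\<in>D. s < t \<and> {s<..<t} \<subseteq> U) \<and>
     disjoint_family_on (\<lambda>(s, t). {s<..<t}) D}"

text \<open>For an open interval this is the total variation over its closure, since the values at
  both endpoints count. As a set function it can also be evaluated on finite unions of intervals;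
  values in \<open>ennreal\<close> allow it before finiteness is known.\<close>

definition variation :: "(real \<Rightarrow> real) \<Rightarrow> real set \<Rightarrow> ennreal" where
  "variation g U = (SUP D\<in>interval_families U. ennreal (\<Sum>(s, t)\<in>D. \<bar>g t - g s\<bar>))"

lemma interval_families_mono: "U \<subseteq> W \<Longrightarrow> D \<in> interval_families U \<Longrightarrow> D \<in> interval_families W"
  unfolding interval_families_def by blast

lemma interval_families_bounds:
  assumes "D \<in> interval_families {a<..<b}" "(s, t) \<in> D"
  shows "a \<le> s" "s < t" "t \<le> b"
  using assms greaterThanLessThan_subseteq_greaterThanLessThan[of s t a b]
  unfolding interval_families_def by auto

lemma sum_lengths_le_measure:
  assumes D: "D \<in> interval_families U" and U: "U \<in> lmeasurable"
  shows "(\<Sum>(s, t)\<in>D. t - s) \<le> measure lebesgue U"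
proof -
  have "(\<Sum>(s, t)\<in>D. t - s) = (\<Sum>p\<in>D. measure lebesgue (case p of (s, t) \<Rightarrow> {s<..<t}))"
    by (rule sum.cong) (use D in \<open>auto simp: interval_families_def\<close>)
  also have "\<dots> = measure lebesgue (\<Union>p\<in>D. case p of (s, t) \<Rightarrow> {s<..<t})"
    by (rule measure_UNION'[symmetric])
       (use D in \<open>auto simp: interval_families_def disjoint_family_on_def pairwise_def disjnt_def\<close>)
  also have "\<dots> \<le> measure lebesgue U"
    by (rule measure_mono_fmeasurable[OF _ _ U]) (use D in \<open>auto simp: interval_families_def split: prod.splits\<close>)
  finally show ?thesis .
qed

lemma abs_cont_on_interval_families:
  assumes g: "abs_cont_on a b g" and e: "e > 0"
  obtains d where "d > 0" "\<And>D. D \<in> interval_families {a<..<b} \<Longrightarrow> (\<Sum>(s, t)\<in>D. t - s) < d \<Longrightarrow>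
    (\<Sum>(s, t)\<in>D. \<bar>g t - g s\<bar>) < e"
proof -
  obtain d where d: "d > 0" and dd: "\<And>(n::nat) s t. (\<forall>i<n. a \<le> s i \<and> s i < t i \<and> t i \<le> b) \<Longrightarrow>
     disjoint_family_on (\<lambda>i. {s i<..<t i}) {..<n} \<Longrightarrow>
     (\<Sum>i<n. t i - s i) < d \<Longrightarrow> (\<Sum>i<n. \<bar>g (t i) - g (s i)\<bar>) < e"
    using g e unfolding abs_cont_on_def by meson
  show ?thesis
  proof (rule that[OF d])
    fix D assume D: "D \<in> interval_families {a<..<b}" and len: "(\<Sum>(s, t)\<in>D. t - s) < d"
    then have "finite D" by (simp add: interval_families_def)
    then obtain f :: "nat \<Rightarrow> real \<times> real" where f: "bij_betw f {..<card D} D"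
      using ex_bij_betw_nat_finite atLeast0LessThan by metis
    have fD: "f i \<in> D" if "i < card D" for i using f that by (auto simp: bij_betw_def)
    have inj: "inj_on f {..<card D}" using f by (auto simp: bij_betw_def)
    have sum: "(\<Sum>(s, t)\<in>D. F s t) = (\<Sum>i<card D. F (fst (f i)) (snd (f i)))" for F :: "real \<Rightarrow> real \<Rightarrow> real"
      using sum.reindex_bij_betw[OF f, of "\<lambda>(s, t). F s t"] by (simp add: case_prod_beta)
    have "(\<Sum>i<card D. \<bar>g (snd (f i)) - g (fst (f i))\<bar>) < e"
    proof (rule dd)
      show "\<forall>i<card D. a \<le> fst (f i) \<and> fst (f i) < snd (f i) \<and> snd (f i) \<le> b"
        using interval_families_bounds[OF D] fD by (metis prod.collapse)
      have "disjoint_family_on (\<lambda>(s, t). {s<..<t}) D" using D by (simp add: interval_families_def)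
      then show "disjoint_family_on (\<lambda>i. {fst (f i)<..<snd (f i)}) {..<card D}"
        unfolding disjoint_family_on_def case_prod_beta
        using fD inj by (metis inj_onD lessThan_iff)
      show "(\<Sum>i<card D. snd (f i) - fst (f i)) < d"
        using len sum[of "\<lambda>s t. t - s"] by simp
    qed
    then show "(\<Sum>(s, t)\<in>D. \<bar>g t - g s\<bar>) < e" using sum[of "\<lambda>s t. \<bar>g t - g s\<bar>"] by simp
  qed
qed

text \<open>The union of a family in \<open>U\<close> and a family in \<open>W\<close> is a family
  in the union. As the intervals are nonempty, the two families share no pair and the sums add up.
  Equality can fail for general sets, because an interval of the union may lie in neither
  part.\<close>

lemma variation_superadditive:
  assumes "U \<inter> W = {}"
  shows "variation g U + variation g W \<le> variation g (U \<union> W)"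
proof -
  have ne: "interval_families S \<noteq> {}" for S
    by (auto simp: interval_families_def disjoint_family_on_def intro: exI[of _ "{}"])
  have "ennreal (\<Sum>(s, t)\<in>D. \<bar>g t - g s\<bar>) + ennreal (\<Sum>(s, t)\<in>E. \<bar>g t - g s\<bar>) \<le> variation g (U \<union> W)"
    if D: "D \<in> interval_families U" and E: "E \<in> interval_families W" for D E
  proof -
    have dj: "p \<notin> E" "(case p of (s, t) \<Rightarrow> {s<..<t}) \<inter> (case q of (s, t) \<Rightarrow> {s<..<t}) = {}"
      if "p \<in> D" "q \<in> E" for p q
    proof -
      show "(case p of (s, t) \<Rightarrow> {s<..<t}) \<inter> (case q of (s, t) \<Rightarrow> {s<..<t}) = {}"
        using D E assms that unfolding interval_families_def by fastforce
      show "p \<notin> E"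
      proof
        assume "p \<in> E"
        moreover obtain s t where p: "p = (s, t)" by (cases p)
        ultimately have "s < t" "{s<..<t} \<subseteq> U \<inter> W"
          using D E that unfolding interval_families_def by auto
        with assms show False by (metis greaterThanLessThan_empty_iff linorder_not_le subset_empty)
      qed
    qed
    have "D \<union> E \<in> interval_families (U \<union> W)"
      unfolding interval_families_def
    proof (intro CollectI conjI)
      show "finite (D \<union> E)" using D E by (simp add: interval_families_def)
      show "\<forall>(s, t)\<in>D \<union> E. s < t \<and> {s<..<t} \<subseteq> U \<union> W"
        using D E unfolding interval_families_def by blast
      show "disjoint_family_on (\<lambda>(s, t). {s<..<t}) (D \<union> E)"
        unfolding disjoint_family_on_def
      proof (intro ballI impI)
        fix p q assume "p \<in> D \<union> E" "q \<in> D \<union> E" "p \<noteq> q"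
        moreover have "disjoint_family_on (\<lambda>(s, t). {s<..<t}) D" "disjoint_family_on (\<lambda>(s, t). {s<..<t}) E"
          using D E by (simp_all add: interval_families_def)
        ultimately show "(case p of (s, t) \<Rightarrow> {s<..<t}) \<inter> (case q of (s, t) \<Rightarrow> {s<..<t}) = {}"
          unfolding disjoint_family_on_def using dj(2)[of p q] dj(2)[of q p] by blast
      qed
    qed
    then have "ennreal (\<Sum>(s, t)\<in>D \<union> E. \<bar>g t - g s\<bar>) \<le> variation g (U \<union> W)"
      unfolding variation_def by (rule SUP_upper)
    moreover have "(\<Sum>(s, t)\<in>D \<union> E. \<bar>g t - g s\<bar>) = (\<Sum>(s, t)\<in>D. \<bar>g t - g s\<bar>) + (\<Sum>(s, t)\<in>E. \<bar>g t - g s\<bar>)"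
      by (rule sum.union_disjoint) (use D E dj(1) in \<open>auto simp: interval_families_def\<close>)
    ultimately show ?thesis by (simp add: sum_nonneg case_prod_beta)
  qed
  then have "variation g U + ennreal (\<Sum>(s, t)\<in>E. \<bar>g t - g s\<bar>) \<le> variation g (U \<union> W)"
    if "E \<in> interval_families W" for E
    unfolding variation_def[of g U] using ne that
    by (subst ennreal_SUP_add_left[symmetric]) (auto intro!: SUP_least)
  then show ?thesis
    unfolding variation_def[of g W] using ne
    by (subst ennreal_SUP_add_right) (auto intro!: SUP_least)
qed

lemma sum_variation_le:
  assumes "finite J" "disjoint_family_on U J"
  shows "(\<Sum>j\<in>J. variation g (U j)) \<le> variation g (\<Union>j\<in>J. U j)"
  using assms
proof (induction J rule: finite_induct)
  case (insert i J)
  then have dj: "U i \<inter> (\<Union>j\<in>J. U j) = {}" "disjoint_family_on U J"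
    by (simp_all add: disjoint_family_on_insert)
  have "(\<Sum>j\<in>insert i J. variation g (U j)) = variation g (U i) + (\<Sum>j\<in>J. variation g (U j))"
    using insert.hyps by simp
  also have "\<dots> \<le> variation g (U i) + variation g (\<Union>j\<in>J. U j)"
    using insert.IH[OF dj(2)] by (rule add_left_mono)
  also have "\<dots> \<le> variation g (U i \<union> (\<Union>j\<in>J. U j))"
    using dj(1) by (rule variation_superadditive)
  finally show ?case by simp
qed simp

text \<open>Converse to superadditivity for adjacent intervals. At most one member of a disjoint
  family straddles the cut \<open>y\<close>; it is replaced by its two halves, which by the triangle
  inequality does not decrease the sum.\<close>

lemma variation_split:
  assumes "x \<le> y" "y \<le> z"
  shows "variation g {x<..<z} \<le> variation g {x<..<y} + variation g {y<..<z}"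
  unfolding variation_def[of g "{x<..<z}"]
proof (rule SUP_least)
  fix D assume D: "D \<in> interval_families {x<..<z}"
  let ?S = "\<lambda>D. \<Sum>(s, t)\<in>D. \<bar>g t - g s\<bar>"
  define L where "L = {p\<in>D. snd p \<le> y}"
  define R where "R = {p\<in>D. y \<le> fst p}"
  define M where "M = {p\<in>D. fst p < y \<and> y < snd p}"
  have fin: "finite D" and lt: "\<And>s t. (s, t) \<in> D \<Longrightarrow> s < t"
    and dj: "disjoint_family_on (\<lambda>(s, t). {s<..<t}) D"
    using D by (auto simp: interval_families_def)
  note bd = interval_families_bounds[OF D]
  have D_eq: "D = L \<union> (R \<union> M)" by (auto simp: L_def R_def M_def)
  have sumD: "?S D = ?S L + (?S R + ?S M)"
    unfolding D_eq
    by (subst sum.union_disjoint, use fin lt in \<open>force simp: L_def R_def M_def\<close>,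
        use fin lt in \<open>force simp: L_def R_def M_def\<close>, use fin lt in \<open>force simp: L_def R_def M_def\<close>)
       (subst sum.union_disjoint, use fin lt in \<open>auto simp: L_def R_def M_def\<close>)
  have djL: "disjoint_family_on (\<lambda>(s, t). {s<..<t}) L" and djR: "disjoint_family_on (\<lambda>(s, t). {s<..<t}) R"
    using dj by (auto simp: L_def R_def disjoint_family_on_def)
  have up: "ennreal (?S E) \<le> variation g U" if "E \<in> interval_families U" for E U
    unfolding variation_def using that by (rule SUP_upper)
  show "ennreal (?S D) \<le> variation g {x<..<y} + variation g {y<..<z}"
  proof (cases "M = {}")
    case True
    have "L \<in> interval_families {x<..<y}" "R \<in> interval_families {y<..<z}"
      using fin bd djL djR by (fastforce simp: interval_families_def L_def R_def)+
    from add_mono[OF up[OF this(1)] up[OF this(2)]] show ?thesis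
      using sumD True by (simp add: ennreal_plus[symmetric] sum_nonneg case_prod_beta del: ennreal_plus)
  next
    case False
    then obtain s t where st: "(s, t) \<in> M" by auto
    have stD: "(s, t) \<in> D" "s < y" "y < t" using st by (auto simp: M_def)
    have dst: "(case p of (s, t) \<Rightarrow> {s<..<t}) \<inter> {s<..<t} = {}" if "p \<in> D" "p \<noteq> (s, t)" for p
      using disjoint_family_onD[OF dj that(1) stD(1) that(2)] by simp
    have M: "M = {(s, t)}"
    proof -
      have "p = (s, t)" if "p \<in> M" for p
      proof (rule ccontr)
        assume "p \<noteq> (s, t)"
        then have "(case p of (s, t) \<Rightarrow> {s<..<t}) \<inter> {s<..<t} = {}"
          using dst that by (simp add: M_def)
        moreover have "y \<in> (case p of (s, t) \<Rightarrow> {s<..<t}) \<inter> {s<..<t}"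
          using that st unfolding M_def by (cases p) simp
        ultimately show False by blast
      qed
      then show ?thesis using st by blast
    qed
    \<comment> \<open>The inserted half must be a new element, otherwise it would not contribute to
      the sum. An equal member of \<open>L\<close> would overlap the straddling interval.\<close>
    have nL: "(s, y) \<notin> L" 
    proof
      assume "(s, y) \<in> L"
      then have "(s, y) \<in> D" "(s, y) \<noteq> (s, t)" using stD by (auto simp: L_def)
      from dst[OF this] stD dense[of s y] show False by auto
    qed
    have nR: "(y, t) \<notin> R" 
    proof
      assume "(y, t) \<in> R"
      then have "(y, t) \<in> D" "(y, t) \<noteq> (s, t)" using stD by (auto simp: R_def)
      from dst[OF this] stD dense[of y t] show False by auto
    qed
    have "insert (s, y) L \<in> interval_families {x<..<y}"
    proof -
      have "disjoint_family_on (\<lambda>(s, t). {s<..<t}) (insert (s, y) L)"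
      proof -
        have "{s<..<y} \<inter> (\<Union>p\<in>L. case p of (s, t) \<Rightarrow> {s<..<t}) = {}"
          using dst stD by (fastforce simp: L_def)
        then show ?thesis using djL nL by (simp add: disjoint_family_on_insert)
      qed
      with fin bd stD show ?thesis by (fastforce simp: interval_families_def L_def)
    qed
    moreover have "insert (y, t) R \<in> interval_families {y<..<z}"
    proof -
      have "disjoint_family_on (\<lambda>(s, t). {s<..<t}) (insert (y, t) R)"
      proof -
        have "{y<..<t} \<inter> (\<Union>p\<in>R. case p of (s, t) \<Rightarrow> {s<..<t}) = {}"
          using dst stD by (fastforce simp: R_def)
        then show ?thesis using djR nR by (simp add: disjoint_family_on_insert)
      qed
      with fin bd stD show ?thesis by (fastforce simp: interval_families_def R_def)
    qed
    ultimately have le: "ennreal (?S (insert (s, y) L)) + ennreal (?S (insert (y, t) R)) \<le>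
        variation g {x<..<y} + variation g {y<..<z}"
      by (intro add_mono up)
    have "?S (insert (s, y) L) = \<bar>g y - g s\<bar> + ?S L" "?S (insert (y, t) R) = \<bar>g t - g y\<bar> + ?S R"
      using nL nR fin by (simp_all add: L_def R_def)
    moreover have "?S D \<le> (\<bar>g y - g s\<bar> + ?S L) + (\<bar>g t - g y\<bar> + ?S R)"
      using sumD M by simp
    moreover have "0 \<le> ?S L" "0 \<le> ?S R" by (auto intro: sum_nonneg)
    ultimately have "ennreal (?S D) \<le> ennreal (?S (insert (s, y) L)) + ennreal (?S (insert (y, t) R))"
      by (simp add: ennreal_plus[symmetric] ennreal_leI del: ennreal_plus)
    also note le
    finally show ?thesis .
  qed
qed

lemma variation_ge:
  assumes "x \<le> y"
  shows "ennreal \<bar>g y - g x\<bar> \<le> variation g {x<..<y}"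
proof (cases "x = y")
  case False
  with assms have "{(x, y)} \<in> interval_families {x<..<y}"
    by (simp add: interval_families_def disjoint_family_on_def)
  then have "ennreal (\<Sum>(s, t)\<in>{(x, y)}. \<bar>g t - g s\<bar>) \<le> variation g {x<..<y}"
    unfolding variation_def by (rule SUP_upper)
  then show ?thesis by simp
qed simp

lemma variation_mono: "U \<subseteq> W \<Longrightarrow> variation g U \<le> variation g W"
  unfolding variation_def by (rule SUP_subset_mono) (auto intro: interval_families_mono)

text \<open>The lengths in a family inside \<open>U\<close> sum to at most the measure of
  \<open>U\<close>, so the same threshold works for all families at once and the bound passes to the
  supremum, as a weak inequality.\<close>

lemma variation_small:
  assumes g: "abs_cont_on a b g" and e: "e > 0"
  obtains d where "d > 0"
    "\<And>U. U \<subseteq> {a<..<b} \<Longrightarrow> U \<in> lmeasurable \<Longrightarrow> measure lebesgue U < d \<Longrightarrow> variation g U \<le> ennreal e"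
proof -
  obtain d where d: "d > 0" and dd: "\<And>D. D \<in> interval_families {a<..<b} \<Longrightarrow> (\<Sum>(s, t)\<in>D. t - s) < d \<Longrightarrow>
    (\<Sum>(s, t)\<in>D. \<bar>g t - g s\<bar>) < e"
    by (rule abs_cont_on_interval_families[OF g e]) (rule that)
  show ?thesis
  proof (rule that[OF d])
    fix U assume U: "U \<subseteq> {a<..<b}" "U \<in> lmeasurable" "measure lebesgue U < d"
    show "variation g U \<le> ennreal e"
      unfolding variation_def
    proof (intro SUP_least ennreal_leI less_imp_le dd)
      fix D assume D: "D \<in> interval_families U"
      show "D \<in> interval_families {a<..<b}" by (rule interval_families_mono[OF U(1) D])
      show "(\<Sum>(s, t)\<in>D. t - s) < d" using sum_lengths_le_measure[OF D U(2)] U(3) by simp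
    qed
  qed
qed

text \<open>Pieces of length \<open>d / 2\<close>, shorter than the threshold \<open>d\<close> for
  the tolerance 1, have variation at most 1. Cutting them off from the right reaches
  \<open>a\<close> after finitely many steps.\<close>

lemma variation_finite:
  assumes g: "abs_cont_on a b g"
  shows "variation g {a<..<b} < \<infinity>"
proof -
  obtain d where d: "d > 0" and dd:
    "\<And>U. U \<subseteq> {a<..<b} \<Longrightarrow> U \<in> lmeasurable \<Longrightarrow> measure lebesgue U < d \<Longrightarrow> variation g U \<le> ennreal 1"
    by (rule variation_small[OF g zero_less_one]) (rule that)
  have step: "variation g {x<..<y} \<le> 1" if "a \<le> x" "y \<le> b" "y - x < d" for x y
  proof (cases "x \<le> y")
    case True
    have "variation g {x<..<y} \<le> ennreal 1"
      by (rule dd) (use that True in auto)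
    then show ?thesis by simp
  next
    case False
    then have "{x<..<y} = {}" by simp
    moreover have "variation g {} \<le> ennreal 1" using d by (intro dd) auto
    ultimately show ?thesis by simp
  qed
  have fin: "variation g {a<..<y} < \<infinity>" if "y \<le> b" "y \<le> a + real n * (d / 2)" for y n
    using that
  proof (induction n arbitrary: y)
    case 0
    then have "variation g {a<..<y} \<le> 1" using d by (intro step) auto
    also have "(1::ennreal) < \<infinity>" by simp
    finally show ?case .
  next
    case (Suc n)
    show ?case
    proof (cases "y - d / 2 \<le> a")
      case True
      then have "variation g {a<..<y} \<le> 1" using d Suc.prems by (intro step) auto
      also have "(1::ennreal) < \<infinity>" by simp
      finally show ?thesis .
    next
      case False
      have "variation g {a<..<y} \<le> variation g {a<..<y - d / 2} + variation g {y - d / 2<..<y}"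
        using False d by (intro variation_split) auto
      also have "variation g {y - d / 2<..<y} \<le> 1"
        using False d Suc.prems by (intro step) auto
      finally have "variation g {a<..<y} \<le> variation g {a<..<y - d / 2} + 1" by (simp add: add_left_mono)
      also have "\<dots> < \<infinity>"
        using Suc.IH[of "y - d / 2"] Suc.prems d by (simp add: field_simps)
      finally show ?thesis .
    qed
  qed
  obtain n where "(b - a) / (d / 2) \<le> real n" using real_arch_simple by blast
  with d have "b \<le> a + real n * (d / 2)" by (simp add: field_simps)
  from fin[OF order_refl this] show ?thesis .
qed

text \<open>The Lebesgue-Stieltjes measure of \<open>p\<close> is absolutely continuous with respect to Lebesgue
  measure, so that \<open>h\<close> is its Radon-Nikodym density.\<close>

lemma absolutely_continuous_mono_imp_integral:
  fixes p :: "real \<Rightarrow> real"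
  assumes ab: "a < b" and mono: "mono_on {a..b} p"
    and ac: "\<And>e. e > 0 \<Longrightarrow> \<exists>d>0. \<forall>D\<in>interval_families {a<..<b}. (\<Sum>(s, t)\<in>D. t - s) < d \<longrightarrow>
      (\<Sum>(s, t)\<in>D. p t - p s) \<le> e"
  obtains h where "h absolutely_integrable_on {a..b}"
    "\<And>x. x \<in> {a..b} \<Longrightarrow> (h has_integral (p x - p a)) {a..x}"
proof -
  \<comment> \<open>The constant extension is monotone on the whole line, as
    \<open>interval_measure\<close> requires.\<close>
  define P where "P x = p (max a (min b x))" for x
  have P: "P x = p x" if "x \<in> {a..b}" for x using that by (simp add: P_def)
  have Pmono: "P x \<le> P y" if "x \<le> y" for x y
    unfolding P_def by (rule mono_onD[OF mono]) (use that ab in auto)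
  \<comment> \<open>Families with a single interval give uniform continuity. Continuity excludes
    atoms, so closed intervals receive exactly the increment of \<open>P\<close>.\<close>
  have unif: "\<exists>d>0. \<forall>x\<in>{a..b}. \<forall>y\<in>{a..b}. dist y x < d \<longrightarrow> dist (p y) (p x) < e" if "e > 0" for e
  proof -
    obtain d where d: "d > 0" and dd: "\<And>D. D \<in> interval_families {a<..<b} \<Longrightarrow> (\<Sum>(s, t)\<in>D. t - s) < d \<Longrightarrow>
      (\<Sum>(s, t)\<in>D. p t - p s) \<le> e / 2"
      using ac[OF half_gt_zero[OF \<open>e > 0\<close>]] by meson
    have *: "\<bar>p y - p x\<bar> < e" if "x \<in> {a..b}" "y \<in> {a..b}" "x < y" "y - x < d" for x y
    proof -
      have "{(x, y)} \<in> interval_families {a<..<b}"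
        using that by (auto simp: interval_families_def disjoint_family_on_def)
      from dd[OF this] that have "p y - p x \<le> e / 2" by simp
      moreover have "p x \<le> p y" using mono_onD[OF mono, of x y] that by simp
      ultimately show ?thesis using \<open>e > 0\<close> by simp
    qed
    have "dist (p y) (p x) < e" if "x \<in> {a..b}" "y \<in> {a..b}" "dist y x < d" for x y
      using *[of x y] *[of y x] that \<open>e > 0\<close>
      by (cases x y rule: linorder_cases) (auto simp: dist_real_def abs_minus_commute)
    with d show ?thesis by blast
  qed
  have "continuous_on {a..b} p"
    unfolding continuous_on_iff using unif by meson
  moreover have "continuous_on UNIV (\<lambda>x::real. max a (min b x))" by (intro continuous_intros)
  ultimately have Pcont: "continuous_on UNIV P"
    unfolding P_def[abs_def] using ab
    by (intro continuous_on_compose2[of "{a..b}" p UNIV "\<lambda>x. max a (min b x)"]) auto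
  define \<mu> where "\<mu> = interval_measure P"
  have \<mu>_Icc: "emeasure \<mu> {x..y} = ennreal (P y - P x)" if "x \<le> y" for x y
    unfolding \<mu>_def by (rule emeasure_interval_measure_Icc[OF that Pmono Pcont])
  have sets_\<mu> [simp, measurable_cong]: "sets \<mu> = sets borel" by (simp add: \<mu>_def)
  \<comment> \<open>A null set is enclosed in an open \<open>U\<close> of measure below the
    threshold \<open>d\<close>, and its part in \<open>{a..b}\<close> is covered by countably many
    non-overlapping intervals inside \<open>U\<close>, whose increments of \<open>p\<close> sum to
    at most \<open>e\<close>.\<close>
  have null: "emeasure \<mu> (A \<inter> {a..b}) = 0" if A: "A \<in> null_sets lborel" for A
  proof -
    have [measurable]: "A \<in> sets borel" using A by auto
    have "emeasure \<mu> (A \<inter> {a..b}) \<le> ennreal e" if "e > 0" for e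
    proof -
      obtain d where d: "d > 0" and dd: "\<And>D. D \<in> interval_families {a<..<b} \<Longrightarrow> (\<Sum>(s, t)\<in>D. t - s) < d \<Longrightarrow>
        (\<Sum>(s, t)\<in>D. p t - p s) \<le> e"
        using ac[OF \<open>e > 0\<close>] by meson
      have "A \<in> lmeasurable" "measure lebesgue A = 0"
        using A null_sets_completionI[OF A] by (auto simp: measure_eq_0_null_sets intro: fmeasurableI_null_sets)
      note A0 = this
      then obtain U where U: "open U" "A \<subseteq> U" "U - A \<in> lmeasurable" "emeasure lebesgue (U - A) < ennreal d"
        using sets_lebesgue_outer_open[of A d] d by (metis fmeasurableD)
      have UA: "U = (U - A) \<union> A" using U(2) by auto
      have Um: "U \<in> lmeasurable" using fmeasurable.Un[OF U(3) A0(1)] UA by simp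
      have "measure lebesgue (U - A) < d"
        using U(3,4) d by (simp add: emeasure_eq_measure2 ennreal_less_iff)
      moreover have "measure lebesgue U \<le> measure lebesgue (U - A) + measure lebesgue A"
        using measure_Un_le[of "U - A" lebesgue A] U(3) A0(1) UA by auto
      ultimately have "measure lebesgue U < d" using A0(2) by simp
      note U = U(1,2) Um this
      \<comment> \<open>Every cell of the covering contains a point of \<open>A\<close> and lies in
        the value of the gauge there, which is \<open>U\<close>. Off \<open>U\<close> the value is
        arbitrary.\<close>
      define \<gamma> where "\<gamma> x = (if x \<in> U then U else UNIV)" for x
      have "gauge \<gamma>" using U by (auto simp: gauge_def \<gamma>_def)
      have "A \<inter> {a..b} \<subseteq> cbox a b" "box a b \<noteq> {}" using ab by auto
      note cov = covering_lemma[OF this(1,2) \<open>gauge \<gamma>\<close>]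
      obtain \<D> where D: "countable \<D>" "\<Union>\<D> \<subseteq> cbox a b"
        "\<And>K. K \<in> \<D> \<Longrightarrow> interior K \<noteq> {} \<and> (\<exists>c d. K = cbox c d)"
        "pairwise (\<lambda>A B. interior A \<inter> interior B = {}) \<D>"
        "\<And>K. K \<in> \<D> \<Longrightarrow> \<exists>x \<in> (A \<inter> {a..b}) \<inter> K. K \<subseteq> \<gamma> x"
        "\<And>u v. cbox u v \<in> \<D> \<Longrightarrow> \<exists>n. \<forall>i\<in>Basis. v \<bullet> i - u \<bullet> i = (b \<bullet> i - a \<bullet> i) / 2 ^ n"
        "A \<inter> {a..b} \<subseteq> \<Union>\<D>"
        by (rule cov) (rule that)
      define s where "s K = Inf K" for K :: "real set"
      define t where "t K = Sup K" for K :: "real set"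
      have st: "K = {s K..t K} \<and> s K < t K \<and> a \<le> s K \<and> t K \<le> b \<and> {s K..t K} \<subseteq> U" if "K \<in> \<D>" for K
      proof -
        from D(3)[OF that] obtain c d where cd: "K = {c..d}" "interior K \<noteq> {}" by auto
        then have "c < d" by simp
        then have "s K = c" "t K = d" using cd by (simp_all add: s_def t_def)
        moreover have "K \<subseteq> {a..b}" using D(2) that by auto
        moreover obtain x where "x \<in> A" "K \<subseteq> \<gamma> x" using D(5)[OF \<open>K \<in> \<D>\<close>] by blast
        then have "K \<subseteq> U" using U(2) by (auto simp: \<gamma>_def subset_iff)
        ultimately show ?thesis using cd \<open>c < d\<close> by auto
      qed
      \<comment> \<open>Finite subfamilies are interval families in \<open>U\<close>, so the
        hypothesis on \<open>p\<close> applies; the countable union inherits the uniform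
        bound.\<close>
      have bound: "measure \<mu> (\<Union>K\<in>F. K) \<le> e" if F: "F \<subseteq> \<D>" "finite F" for F
      proof -
        let ?f = "\<lambda>K. (s K, t K)"
        have inj: "inj_on ?f F"
        proof (rule inj_onI)
          fix K L assume "K \<in> F" "L \<in> F" "?f K = ?f L"
          with st[of K] st[of L] F(1) show "K = L" by auto
        qed
        have "measure \<mu> (\<Union>K\<in>F. K) \<le> (\<Sum>K\<in>F. measure \<mu> K)"
        proof (rule measure_UNION_le[OF F(2)])
          fix K assume "K \<in> F"
          with st[of K] F(1) have "K = {s K..t K}" by auto
          then show "K \<in> sets \<mu>" by (metis atLeastAtMost_borel sets_\<mu>)
        qed
        also have "\<dots> = (\<Sum>K\<in>F. p (t K) - p (s K))"
        proof (rule sum.cong[OF refl])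
          fix K assume "K \<in> F"
          then have *: "K = {s K..t K}" "s K < t K" "a \<le> s K" "t K \<le> b" using st F by blast+
          have "emeasure \<mu> {s K..t K} = ennreal (p (t K) - p (s K))"
            using \<mu>_Icc[of "s K" "t K"] P[of "s K"] P[of "t K"] *(2-4) by simp
          then have "emeasure \<mu> K = ennreal (p (t K) - p (s K))" using *(1) by metis
          moreover have "p (s K) \<le> p (t K)" using mono_onD[OF mono, of "s K" "t K"] *(2-4) by auto
          ultimately show "measure \<mu> K = p (t K) - p (s K)" by (simp add: measure_def)
        qed
        also have "\<dots> = (\<Sum>(s, t)\<in>?f ` F. p t - p s)" by (simp add: sum.reindex[OF inj])
        also have "\<dots> \<le> e"
        proof (rule dd)
          have dj: "disjoint_family_on (\<lambda>(s, t). {s<..<t}) (?f ` F)"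
            unfolding disjoint_family_on_def
          proof (intro ballI impI)
            fix p q assume "p \<in> ?f ` F" "q \<in> ?f ` F" "p \<noteq> q"
            then obtain K L where KL: "K \<in> F" "L \<in> F" "K \<noteq> L" "p = ?f K" "q = ?f L" by auto
            with F D(4) have "interior K \<inter> interior L = {}" unfolding pairwise_def by blast
            moreover have "K = {s K..t K}" "L = {s L..t L}" using st KL F by blast+
            ultimately have "interior {s K..t K} \<inter> interior {s L..t L} = {}" by simp
            then show "(case p of (s, t) \<Rightarrow> {s<..<t}) \<inter> (case q of (s, t) \<Rightarrow> {s<..<t}) = {}"
              unfolding KL by (simp only: interior_atLeastAtMost_real prod.case)
          qed
          have sub: "s K < t K \<and> {s K<..<t K} \<subseteq> U \<inter> {a<..<b}" if "K \<in> F" for K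
          proof -
            have "s K < t K" "a \<le> s K" "t K \<le> b" "{s K..t K} \<subseteq> U" using st that F by blast+
            then show ?thesis by auto
          qed
          show "?f ` F \<in> interval_families {a<..<b}"
            using dj sub F by (auto simp: interval_families_def)
          have "?f ` F \<in> interval_families U"
            using dj sub F by (auto simp: interval_families_def)
          from sum_lengths_le_measure[OF this U(3)] U(4) show "(\<Sum>(s, t)\<in>?f ` F. t - s) < d" by simp
        qed
        finally show ?thesis .
      qed
      have fm: "K \<in> fmeasurable \<mu>" if "K \<in> \<D>" for K
      proof -
        have *: "K = {s K..t K}" "s K < t K" using st[OF that] by blast+
        have "{s K..t K} \<in> fmeasurable \<mu>" using *(2) \<mu>_Icc[of "s K" "t K"]
          by (intro fmeasurableI) (auto simp: less_top)
        with *(1) show ?thesis by metis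
      qed
      have fmU: "(\<Union>K\<in>\<D>. K) \<in> fmeasurable \<mu>" by (rule fmeasurable_UN_bound[OF D(1) fm bound])
      have "emeasure \<mu> (A \<inter> {a..b}) \<le> emeasure \<mu> (\<Union>K\<in>\<D>. K)"
        by (rule emeasure_mono) (use D(7) fmU in auto)
      also have "\<dots> = ennreal (measure \<mu> (\<Union>K\<in>\<D>. K))" by (rule emeasure_eq_measure2[OF fmU])
      also have "\<dots> \<le> ennreal e" by (intro ennreal_leI measure_UN_bound[OF D(1) fm bound])
      finally show ?thesis .
    qed
    then have "emeasure \<mu> (A \<inter> {a..b}) \<le> 0 + ennreal e" if "e > 0" for e using that by simp
    then have "emeasure \<mu> (A \<inter> {a..b}) \<le> 0" by (rule ennreal_le_epsilon)
    then show ?thesis by simp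
  qed
  \<comment> \<open>Absolute continuity has been shown inside \<open>{a..b}\<close>; cutting the
    measure off makes it a global statement, to which Radon-Nikodym applies.\<close>
  define \<nu> where "\<nu> = density \<mu> (indicator {a..b})"
  have \<nu>: "emeasure \<nu> A = emeasure \<mu> (A \<inter> {a..b})" if "A \<in> sets borel" for A
  proof -
    have "emeasure \<nu> A = (\<integral>\<^sup>+x. indicator {a..b} x * indicator A x \<partial>\<mu>)"
      unfolding \<nu>_def using that by (intro emeasure_density) auto
    also have "\<dots> = (\<integral>\<^sup>+x. indicator (A \<inter> {a..b}) x \<partial>\<mu>)"
      by (simp add: indicator_inter_arith mult.commute)
    also have "\<dots> = emeasure \<mu> (A \<inter> {a..b})" using that by (intro nn_integral_indicator) auto
    finally show ?thesis .
  qed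
  have "absolutely_continuous lborel \<nu>"
    unfolding absolutely_continuous_def
  proof
    fix A :: "real set" assume A: "A \<in> null_sets lborel"
    then have "A \<in> sets borel" by auto
    with null[OF A] \<nu>[of A] show "A \<in> null_sets \<nu>"
      by (intro null_setsI) (simp_all add: \<nu>_def)
  qed
  then obtain f where f [measurable]: "f \<in> borel_measurable lborel" and dens: "density lborel f = \<nu>"
    using sigma_finite_measure.Radon_Nikodym[OF sigma_finite_lborel, of \<nu>] by (auto simp: \<nu>_def)
  have fint: "(\<integral>\<^sup>+x. f x * indicator {a..y} x \<partial>lborel) = ennreal (p y - p a)" if "y \<in> {a..b}" for y
  proof -
    have "(\<integral>\<^sup>+x. f x * indicator {a..y} x \<partial>lborel) = emeasure \<nu> {a..y}"
      unfolding dens[symmetric] by (simp add: emeasure_density)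
    also have "\<dots> = emeasure \<mu> {a..y}"
      using \<nu>[of "{a..y}"] that by (simp add: Int_absorb2)
    also have "\<dots> = ennreal (p y - p a)" using \<mu>_Icc[of a y] P[of a] P[of y] that ab by simp
    finally show ?thesis .
  qed
  have "(\<integral>\<^sup>+x. f x * indicator {a..b} x \<partial>lborel) \<noteq> \<infinity>" using fint[of b] ab by simp
  then have "AE x in lborel. f x * indicator {a..b} x \<noteq> \<infinity>"
    by (intro nn_integral_PInf_AE) auto
  then have AEf: "AE x in lborel. x \<in> {a..b} \<longrightarrow> ennreal (enn2real (f x)) = f x"
    by eventually_elim (auto simp: indicator_def less_top)
  define h where "h x = enn2real (f x)" for x
  have [measurable]: "h \<in> borel_measurable borel" using f unfolding h_def[abs_def] by simp
  have hi: "(h has_integral (p y - p a)) {a..y}" if y: "y \<in> {a..b}" for y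
  proof -
    have "(\<integral>\<^sup>+x. ennreal (h x * indicator {a..y} x) \<partial>lborel) = (\<integral>\<^sup>+x. f x * indicator {a..y} x \<partial>lborel)"
      by (intro nn_integral_cong_AE eventually_mono[OF AEf]) (use y in \<open>auto simp: h_def indicator_def\<close>)
    then have "(\<integral>\<^sup>+x. ennreal (h x * indicator {a..y} x) \<partial>lborel) = ennreal (p y - p a)"
      using fint[OF y] by simp
    then have "((\<lambda>x. h x * indicator {a..y} x) has_integral (p y - p a)) UNIV"
      using mono_onD[OF mono, of a y] y ab
      by (intro nn_integral_has_integral) (auto simp: h_def)
    then have "((\<lambda>x. if x \<in> {a..y} then h x else 0) has_integral (p y - p a)) UNIV"
      by (rule has_integral_eq[rotated]) (simp add: indicator_def)
    then show ?thesis by (simp only: has_integral_restrict_UNIV)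
  qed
  show ?thesis
  proof (rule that[OF _ hi])
    show "h absolutely_integrable_on {a..b}"
      using hi[of b] ab by (intro nonnegative_absolutely_integrable_1) (auto simp: h_def)
  qed
qed

text \<open>Jordan decomposition: with \<open>v\<close> the variation from \<open>a\<close>, both
  \<open>v\<close> and \<open>v - g\<close> are nondecreasing and inherit absolute continuity from
  \<open>g\<close>, and the density of \<open>g\<close> is the difference of theirs.\<close>

lemma abs_cont_on_imp_integral:
  assumes ab: "a < b" and g: "abs_cont_on a b g"
  obtains h where "h absolutely_integrable_on {a..b}"
    "\<And>x. x \<in> {a..b} \<Longrightarrow> (h has_integral (g x - g a)) {a..x}"
proof -
  define v where "v x = enn2real (variation g {a<..<x})" for x
  have fin: "variation g U < \<infinity>" if "U \<subseteq> {a<..<b}" for U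
    using variation_mono[OF that] variation_finite[OF g] by (rule order.strict_trans1)
  have v: "ennreal (v x) = variation g {a<..<x}" if "x \<le> b" for x
    using fin[of "{a<..<x}"] that by (simp add: v_def subset_iff)
  have v0: "0 \<le> v x" for x by (simp add: v_def)
  \<comment> \<open>Superadditivity bounds increments of \<open>g\<close> by those of
    \<open>v\<close>; in the other direction, \<open>variation_split\<close> gives
    \<open>upper\<close>.\<close>
  have dom: "\<bar>g y - g x\<bar> \<le> v y - v x" if "a \<le> x" "x \<le> y" "y \<le> b" for x y
  proof -
    have "ennreal (v x) + ennreal \<bar>g y - g x\<bar> \<le> variation g {a<..<x} + variation g {x<..<y}"
      using variation_ge[OF that(2), of g] v[of x] that by (simp add: add_left_mono)
    also have "\<dots> \<le> variation g ({a<..<x} \<union> {x<..<y})" by (rule variation_superadditive) auto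
    also have "\<dots> \<le> variation g {a<..<y}" by (rule variation_mono) (use that in auto)
    also have "\<dots> = ennreal (v y)" using v that by simp
    finally have "ennreal (v x + \<bar>g y - g x\<bar>) \<le> ennreal (v y)" using v0 by simp
    then show ?thesis using v0[of y] by (simp add: ennreal_le_iff)
  qed
  have upper: "ennreal (v y - v x) \<le> variation g {x<..<y}" if "a \<le> x" "x \<le> y" "y \<le> b" for x y
  proof -
    have xy: "{x<..<y} \<subseteq> {a<..<b}" using that by auto
    have "ennreal (v y) \<le> ennreal (v x) + variation g {x<..<y}"
      using variation_split[OF that(1,2), of g] v[of x] v[of y] that by simp
    then show ?thesis using fin[OF xy] v0
      by (cases "variation g {x<..<y}") (auto simp: ennreal_plus[symmetric] ennreal_le_iff simp del: ennreal_plus)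
  qed
  \<comment> \<open>By \<open>upper\<close> each increment of \<open>v\<close> is at most the
    variation over its interval, and these add up to at most the variation over the union, a set of
    small measure.\<close>
  have acv: "\<exists>d>0. \<forall>D\<in>interval_families {a<..<b}. (\<Sum>(s, t)\<in>D. t - s) < d \<longrightarrow>
      (\<Sum>(s, t)\<in>D. v t - v s) \<le> e" if e: "e > 0" for e
  proof -
    obtain d where d: "d > 0" and dd:
      "\<And>U. U \<subseteq> {a<..<b} \<Longrightarrow> U \<in> lmeasurable \<Longrightarrow> measure lebesgue U < d \<Longrightarrow> variation g U \<le> ennreal e"
      by (rule variation_small[OF g e]) (rule that)
    have "(\<Sum>(s, t)\<in>D. v t - v s) \<le> e"
      if D: "D \<in> interval_families {a<..<b}" and len: "(\<Sum>(s, t)\<in>D. t - s) < d" for D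
    proof -
      let ?I = "\<lambda>(s, t). {s<..<t::real}"
      note bd = interval_families_bounds[OF D]
      have finD: "finite D" and dj: "disjoint_family_on ?I D"
        using D by (auto simp: interval_families_def)
      have nn: "0 \<le> v t - v s" if "(s, t) \<in> D" for s t
        using dom[of s t] bd[OF that] abs_ge_zero[of "g t - g s"] by linarith
      have "ennreal (\<Sum>(s, t)\<in>D. v t - v s) = (\<Sum>p\<in>D. ennreal (v (snd p) - v (fst p)))"
        unfolding case_prod_beta by (rule sum_ennreal[symmetric]) (use nn in force)
      also have "\<dots> \<le> (\<Sum>p\<in>D. variation g (?I p))"
        by (rule sum_mono) (use bd in \<open>force intro: upper less_imp_le\<close>)
      also have "\<dots> \<le> variation g (\<Union>p\<in>D. ?I p)" by (rule sum_variation_le[OF finD dj])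
      also have "\<dots> \<le> ennreal e"
      proof (rule dd)
        show "(\<Union>p\<in>D. ?I p) \<subseteq> {a<..<b}" using D by (auto simp: interval_families_def)
        show "(\<Union>p\<in>D. ?I p) \<in> lmeasurable" by (rule fmeasurable.finite_UN[OF finD]) auto
        have "measure lebesgue (\<Union>p\<in>D. ?I p) \<le> (\<Sum>p\<in>D. measure lebesgue (?I p))"
          by (rule measure_UNION_le[OF finD]) auto
        also have "\<dots> = (\<Sum>(s, t)\<in>D. t - s)"
          by (rule sum.cong[OF refl]) (use bd in \<open>auto simp: less_imp_le\<close>)
        finally show "measure lebesgue (\<Union>p\<in>D. ?I p) < d" using len by simp
      qed
      finally show ?thesis using e by (simp add: ennreal_le_iff)
    qed
    with d show ?thesis by blast
  qed
  have acw: "\<exists>d>0. \<forall>D\<in>interval_families {a<..<b}. (\<Sum>(s, t)\<in>D. t - s) < d \<longrightarrow>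
      (\<Sum>(s, t)\<in>D. (v t - g t) - (v s - g s)) \<le> e" if e: "e > 0" for e
  proof -
    \<comment> \<open>Increments of \<open>v - g\<close> are at most twice those of
      \<open>v\<close>, hence the tolerance \<open>e / 2\<close>.\<close>
    obtain d where d: "d > 0" and dd: "\<And>D. D \<in> interval_families {a<..<b} \<Longrightarrow> (\<Sum>(s, t)\<in>D. t - s) < d \<Longrightarrow>
      (\<Sum>(s, t)\<in>D. v t - v s) \<le> e / 2"
      using acv[OF half_gt_zero[OF e]] by meson
    have "(\<Sum>(s, t)\<in>D. (v t - g t) - (v s - g s)) \<le> e"
      if D: "D \<in> interval_families {a<..<b}" and len: "(\<Sum>(s, t)\<in>D. t - s) < d" for D
    proof -
      have "(\<Sum>(s, t)\<in>D. (v t - g t) - (v s - g s)) \<le> (\<Sum>(s, t)\<in>D. 2 * (v t - v s))"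
      proof (rule sum_mono, clarify)
        fix s t assume "(s, t) \<in> D"
        from interval_families_bounds[OF D this] have "\<bar>g t - g s\<bar> \<le> v t - v s" by (intro dom) auto
        then have "- (g t - g s) \<le> v t - v s" by (rule abs_le_D2)
        then show "(v t - g t) - (v s - g s) \<le> 2 * (v t - v s)" by (simp add: algebra_simps)
      qed
      also have "\<dots> = 2 * (\<Sum>(s, t)\<in>D. v t - v s)" by (simp add: sum_distrib_left case_prod_beta)
      finally show ?thesis using dd[OF D len] by simp
    qed
    with d show ?thesis by blast
  qed
  have mv: "mono_on {a..b} v"
  proof (rule mono_onI)
    fix x y assume "x \<in> {a..b}" "y \<in> {a..b}" "x \<le> y"
    with dom[of x y] show "v x \<le> v y" by simp
  qed
  have mw: "mono_on {a..b} (\<lambda>x. v x - g x)"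
  proof (rule mono_onI)
    fix x y assume "x \<in> {a..b}" "y \<in> {a..b}" "x \<le> y"
    with dom[of x y] show "v x - g x \<le> v y - g y" by simp
  qed
  obtain h1 where h1: "h1 absolutely_integrable_on {a..b}"
    "\<And>x. x \<in> {a..b} \<Longrightarrow> (h1 has_integral (v x - v a)) {a..x}"
    by (rule absolutely_continuous_mono_imp_integral[OF ab mv acv]) (assumption, rule that)
  obtain h2 where h2: "h2 absolutely_integrable_on {a..b}"
    "\<And>x. x \<in> {a..b} \<Longrightarrow> (h2 has_integral ((v x - g x) - (v a - g a))) {a..x}"
    by (rule absolutely_continuous_mono_imp_integral[OF ab mw acw]) (assumption, rule that)
  show ?thesis
  proof (rule that)
    show "(\<lambda>x. h1 x - h2 x) absolutely_integrable_on {a..b}" by (rule set_integral_diff(1)[OF h1(1) h2(1)])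
    fix x assume "x \<in> {a..b}"
    from has_integral_diff[OF h1(2)[OF this] h2(2)[OF this]]
    show "((\<lambda>x. h1 x - h2 x) has_integral (g x - g a)) {a..x}" by (simp add: algebra_simps)
  qed
qed

section \<open>Fubini's theorem for Lebesgue measurable functions\<close>

lemma AE_lebesgue_iff: "(AE x in lebesgue. P x) \<longleftrightarrow> (AE x in lborel. P x)"
  by (rule AE_completion_iff)

text \<open>Composition preserves Lebesgue measurability here because a projection pulls null sets
  of the line back to null sets of the plane; \<open>f\<close> may thus be replaced by a Borel
  version.\<close>

lemma borel_measurable_lebesgue_fst_snd:
  fixes f :: "real \<Rightarrow> real"
  assumes "f \<in> borel_measurable lebesgue"
  shows "(\<lambda>p :: real \<times> real. f (fst p)) \<in> borel_measurable lebesgue"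
    and "(\<lambda>p :: real \<times> real. f (snd p)) \<in> borel_measurable lebesgue"
proof -
  obtain f0 where f0 [measurable]: "f0 \<in> borel_measurable lborel" and "AE x in lborel. f x = f0 x"
    using completion_ex_borel_measurable_real[OF assms] by blast
  then obtain N where N: "N \<in> null_sets lborel" "{x. f x \<noteq> f0 x} \<subseteq> N"
    unfolding eventually_ae_filter by auto
  then have [measurable]: "N \<in> sets borel" by auto
  have nN: "AE x in lborel. x \<notin> N" using N(1) by (rule AE_not_in)
  have "AE p in lborel \<Otimes>\<^sub>M lborel. fst (p :: real \<times> real) \<notin> N"
  proof (rule lborel_pair.AE_pair_measure)
    show "{p \<in> space (lborel \<Otimes>\<^sub>M lborel). fst (p :: real \<times> real) \<notin> N} \<in> sets (lborel \<Otimes>\<^sub>M lborel)" by measurable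
    show "AE x in lborel. AE y in lborel. fst (x :: real, y :: real) \<notin> N"
      using nN by (rule eventually_mono) simp
  qed
  then have 1: "AE p in (lebesgue :: (real \<times> real) measure). f0 (fst p) = f (fst p)"
    unfolding AE_lebesgue_iff lborel_prod by (rule eventually_mono) (use N(2) in force)
  have "AE p in lborel \<Otimes>\<^sub>M lborel. snd (p :: real \<times> real) \<notin> N"
  proof (rule lborel_pair.AE_pair_measure)
    show "{p \<in> space (lborel \<Otimes>\<^sub>M lborel). snd (p :: real \<times> real) \<notin> N} \<in> sets (lborel \<Otimes>\<^sub>M lborel)" by measurable
    show "AE x in lborel. AE y in lborel. snd (x :: real, y :: real) \<notin> N" using nN by simp
  qed
  then have 2: "AE p in (lebesgue :: (real \<times> real) measure). f0 (snd p) = f (snd p)"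
    unfolding AE_lebesgue_iff lborel_prod by (rule eventually_mono) (use N(2) in force)
  have "(\<lambda>p :: real \<times> real. f0 (fst p)) \<in> borel_measurable lborel"
    "(\<lambda>p :: real \<times> real. f0 (snd p)) \<in> borel_measurable lborel"
    by (simp_all add: lborel_prod[symmetric])
  then show "(\<lambda>p :: real \<times> real. f (fst p)) \<in> borel_measurable lebesgue"
    "(\<lambda>p :: real \<times> real. f (snd p)) \<in> borel_measurable lebesgue"
    using borel_measurable_AE[OF measurable_completion 1] borel_measurable_AE[OF measurable_completion 2] by auto
qed

text \<open>Lebesgue measure on the plane is the completion of a product measure and not itself a
  product. Fubini is applied to the Borel version and carried back along the two sectionwise
  equalities; the second one comes from the symmetry of the product under swapping.\<close>

lemma lebesgue_borel_version:
  fixes Q :: "real \<times> real \<Rightarrow> real"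
  assumes "Q \<in> borel_measurable lebesgue"
  obtains Q0 where "Q0 \<in> borel_measurable (lborel \<Otimes>\<^sub>M lborel)"
    "AE x in lborel. AE y in lborel. Q0 (x, y) = Q (x, y)"
    "AE y in lborel. AE x in lborel. Q0 (x, y) = Q (x, y)"
proof -
  obtain Q0 where Q0: "Q0 \<in> borel_measurable lborel" and "AE x in lborel. Q x = Q0 x"
    using completion_ex_borel_measurable_real[OF assms] by blast
  then have ae: "AE p in lborel \<Otimes>\<^sub>M lborel. Q0 p = Q p"
    unfolding lborel_prod by (rule_tac eventually_mono) auto
  then have "AE x in lborel. AE y in lborel. Q0 (x, y) = Q (x, y)"
    by (rule lborel_pair.AE_pair)
  moreover have "AE y in lborel. AE x in lborel. Q0 (x, y) = Q (x, y)"
  proof -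
    have "AE p in distr (lborel \<Otimes>\<^sub>M lborel) (lborel \<Otimes>\<^sub>M lborel) (\<lambda>(x, y). (y, x)). Q0 p = Q p"
      using ae unfolding lborel_pair.distr_pair_swap[symmetric] .
    then have "AE p in lborel \<Otimes>\<^sub>M lborel. Q0 (prod.swap p) = Q (prod.swap p)"
      by (drule_tac AE_distrD[rotated]) (auto simp: case_prod_beta prod.swap_def)
    from lborel_pair.AE_pair[OF this] show ?thesis by simp
  qed
  ultimately show ?thesis using Q0 by (intro that) (simp_all add: lborel_prod)
qed

lemma AE_section_measurable:
  fixes Q :: "real \<times> real \<Rightarrow> real"
  assumes "Q \<in> borel_measurable lebesgue"
  shows "AE x in lebesgue. (\<lambda>y. Q (x, y)) \<in> borel_measurable lebesgue"
    and "AE y in lebesgue. (\<lambda>x. Q (x, y)) \<in> borel_measurable lebesgue"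
proof -
  obtain Q0 where Q0 [measurable]: "Q0 \<in> borel_measurable (lborel \<Otimes>\<^sub>M lborel)"
    and ae: "AE x in lborel. AE y in lborel. Q0 (x, y) = Q (x, y)"
    "AE y in lborel. AE x in lborel. Q0 (x, y) = Q (x, y)"
    by (rule lebesgue_borel_version[OF assms]) (rule that)
  have 1: "(\<lambda>y. Q0 (x, y)) \<in> borel_measurable lebesgue" for x
    by (rule measurable_completion) measurable
  have 2: "(\<lambda>x. Q0 (x, y)) \<in> borel_measurable lebesgue" for y
    by (rule measurable_completion) measurable
  show "AE x in lebesgue. (\<lambda>y. Q (x, y)) \<in> borel_measurable lebesgue"
    unfolding AE_lebesgue_iff
    by (rule eventually_mono[OF ae(1)]) (rule borel_measurable_AE[OF 1], simp add: AE_lebesgue_iff)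
  show "AE y in lebesgue. (\<lambda>x. Q (x, y)) \<in> borel_measurable lebesgue"
    unfolding AE_lebesgue_iff
    by (rule eventually_mono[OF ae(2)]) (rule borel_measurable_AE[OF 2], simp add: AE_lebesgue_iff)
qed

lemma lebesgue_Tonelli:
  fixes Q :: "real \<times> real \<Rightarrow> real"
  assumes "Q \<in> borel_measurable lebesgue"
  shows "(\<integral>\<^sup>+x. \<integral>\<^sup>+y. ennreal (Q (x, y)) \<partial>lebesgue \<partial>lebesgue) = (\<integral>\<^sup>+y. \<integral>\<^sup>+x. ennreal (Q (x, y)) \<partial>lebesgue \<partial>lebesgue)"
proof -
  obtain Q0 where Q0 [measurable]: "Q0 \<in> borel_measurable (lborel \<Otimes>\<^sub>M lborel)"
    and ae: "AE x in lborel. AE y in lborel. Q0 (x, y) = Q (x, y)"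
    "AE y in lborel. AE x in lborel. Q0 (x, y) = Q (x, y)"
    by (rule lebesgue_borel_version[OF assms]) (rule that)
  have "(\<integral>\<^sup>+x. \<integral>\<^sup>+y. ennreal (Q (x, y)) \<partial>lborel \<partial>lborel) = (\<integral>\<^sup>+x. \<integral>\<^sup>+y. ennreal (Q0 (x, y)) \<partial>lborel \<partial>lborel)"
    by (rule nn_integral_cong_AE, rule eventually_mono[OF ae(1)])
       (rule nn_integral_cong_AE, auto elim: eventually_mono)
  also have "\<dots> = (\<integral>\<^sup>+y. \<integral>\<^sup>+x. ennreal (Q0 (x, y)) \<partial>lborel \<partial>lborel)"
    by (rule lborel_pair.Fubini[symmetric]) measurable
  also have "\<dots> = (\<integral>\<^sup>+y. \<integral>\<^sup>+x. ennreal (Q (x, y)) \<partial>lborel \<partial>lborel)"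
    by (rule nn_integral_cong_AE, rule eventually_mono[OF ae(2)])
       (rule nn_integral_cong_AE, auto elim: eventually_mono)
  finally show ?thesis by (simp add: nn_integral_completion)
qed

text \<open>On the null set of exceptional sections the inner integral may be the default 0 or
  anything else. The outer integrands are measurable because they agree almost everywhere with those
  of the Borel version.\<close>

lemma lebesgue_Fubini:
  fixes Q :: "real \<times> real \<Rightarrow> real"
  assumes Q: "Q \<in> borel_measurable lebesgue"
    and fin: "(\<integral>\<^sup>+x. \<integral>\<^sup>+y. ennreal \<bar>Q (x, y)\<bar> \<partial>lebesgue \<partial>lebesgue) < \<infinity>"
  shows "integrable lebesgue (\<lambda>x. LINT y|lebesgue. Q (x, y))"
    and "integrable lebesgue (\<lambda>y. LINT x|lebesgue. Q (x, y))"
    and "(LINT x|lebesgue. LINT y|lebesgue. Q (x, y)) = (LINT y|lebesgue. LINT x|lebesgue. Q (x, y))"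
proof -
  obtain Q0 where Q0 [measurable]: "Q0 \<in> borel_measurable (lborel \<Otimes>\<^sub>M lborel)"
    and ae: "AE x in lborel. AE y in lborel. Q0 (x, y) = Q (x, y)"
    "AE y in lborel. AE x in lborel. Q0 (x, y) = Q (x, y)"
    by (rule lebesgue_borel_version[OF Q]) (rule that)
  have "(\<integral>\<^sup>+p. ennreal (norm (Q0 p)) \<partial>(lborel \<Otimes>\<^sub>M lborel)) = (\<integral>\<^sup>+x. \<integral>\<^sup>+y. ennreal \<bar>Q0 (x, y)\<bar> \<partial>lborel \<partial>lborel)"
    by (simp add: lborel.nn_integral_fst[symmetric])
  also have "\<dots> = (\<integral>\<^sup>+x. \<integral>\<^sup>+y. ennreal \<bar>Q (x, y)\<bar> \<partial>lborel \<partial>lborel)"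
    by (rule nn_integral_cong_AE, rule eventually_mono[OF ae(1)])
       (rule nn_integral_cong_AE, auto elim: eventually_mono)
  also have "\<dots> < \<infinity>" using fin by (simp add: nn_integral_completion)
  finally have int: "integrable (lborel \<Otimes>\<^sub>M lborel) Q0" by (intro integrableI_bounded Q0)
  have int1: "integrable lborel (\<lambda>x. LINT y|lborel. Q0 (x, y))" by (rule lborel_pair.integrable_fst'[OF int])
  have int2: "integrable lborel (\<lambda>y. LINT x|lborel. Q0 (x, y))"
    using lborel_pair.integrable_snd[of "\<lambda>x y. Q0 (x, y)"] int by simp
  have eq: "(LINT x|lborel. LINT y|lborel. Q0 (x, y)) = (LINT y|lborel. LINT x|lborel. Q0 (x, y))"
    using lborel_pair.Fubini_integral[of "\<lambda>x y. Q0 (x, y)"] int by simp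
  have s1: "(LINT y|lebesgue. Q (x, y)) = (LINT y|lborel. Q0 (x, y))" if "AE y in lborel. Q0 (x, y) = Q (x, y)" for x
  proof -
    have m: "(\<lambda>y. Q0 (x, y)) \<in> borel_measurable lborel" by measurable
    have "AE y in lebesgue. Q0 (x, y) = Q (x, y)" using that by (simp add: AE_lebesgue_iff)
    moreover from borel_measurable_AE[OF measurable_completion[OF m] this]
    have "(LINT y|lebesgue. Q (x, y)) = (LINT y|lebesgue. Q0 (x, y))"
      using calculation measurable_completion[OF m] by (intro integral_cong_AE) (auto elim: eventually_mono)
    ultimately show ?thesis by (simp add: integral_completion[OF m])
  qed
  have s2: "(LINT x|lebesgue. Q (x, y)) = (LINT x|lborel. Q0 (x, y))" if "AE x in lborel. Q0 (x, y) = Q (x, y)" for y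
  proof -
    have m: "(\<lambda>x. Q0 (x, y)) \<in> borel_measurable lborel" by measurable
    have "AE x in lebesgue. Q0 (x, y) = Q (x, y)" using that by (simp add: AE_lebesgue_iff)
    moreover from borel_measurable_AE[OF measurable_completion[OF m] this]
    have "(LINT x|lebesgue. Q (x, y)) = (LINT x|lebesgue. Q0 (x, y))"
      using calculation measurable_completion[OF m] by (intro integral_cong_AE) (auto elim: eventually_mono)
    ultimately show ?thesis by (simp add: integral_completion[OF m])
  qed
  have r1: "AE x in lebesgue. (LINT y|lborel. Q0 (x, y)) = (LINT y|lebesgue. Q (x, y))"
    unfolding AE_lebesgue_iff by (rule eventually_mono[OF ae(1)]) (simp add: s1)
  have r2: "AE y in lebesgue. (LINT x|lborel. Q0 (x, y)) = (LINT x|lebesgue. Q (x, y))"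
    unfolding AE_lebesgue_iff by (rule eventually_mono[OF ae(2)]) (simp add: s2)
  have L1: "integrable lebesgue (\<lambda>x. LINT y|lborel. Q0 (x, y))"
    using int1 by (subst integrable_completion) auto
  have L2: "integrable lebesgue (\<lambda>y. LINT x|lborel. Q0 (x, y))"
    using int2 by (subst integrable_completion) auto
  have m1: "(\<lambda>x. LINT y|lebesgue. Q (x, y)) \<in> borel_measurable lebesgue"
    by (rule borel_measurable_AE[OF borel_measurable_integrable[OF L1] r1])
  have m2: "(\<lambda>y. LINT x|lebesgue. Q (x, y)) \<in> borel_measurable lebesgue"
    by (rule borel_measurable_AE[OF borel_measurable_integrable[OF L2] r2])
  show "integrable lebesgue (\<lambda>x. LINT y|lebesgue. Q (x, y))"
    by (rule integrable_cong_AE_imp[OF L1 m1]) (use r1 in \<open>auto elim: eventually_mono\<close>)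
  show "integrable lebesgue (\<lambda>y. LINT x|lebesgue. Q (x, y))"
    by (rule integrable_cong_AE_imp[OF L2 m2]) (use r2 in \<open>auto elim: eventually_mono\<close>)
  have "(LINT x|lebesgue. LINT y|lebesgue. Q (x, y)) = (LINT x|lebesgue. LINT y|lborel. Q0 (x, y))"
    using m1 L1 r1 by (intro integral_cong_AE) (auto elim: eventually_mono)
  also have "\<dots> = (LINT x|lborel. LINT y|lborel. Q0 (x, y))"
    using int1 by (intro integral_completion) auto
  also note eq
  also have "(LINT y|lborel. LINT x|lborel. Q0 (x, y)) = (LINT y|lebesgue. LINT x|lborel. Q0 (x, y))"
    using int2 by (intro integral_completion[symmetric]) auto
  also have "\<dots> = (LINT y|lebesgue. LINT x|lebesgue. Q (x, y))"
    using m2 L2 r2 by (intro integral_cong_AE) (auto elim: eventually_mono)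
  finally show "(LINT x|lebesgue. LINT y|lebesgue. Q (x, y)) = (LINT y|lebesgue. LINT x|lebesgue. Q (x, y))" .
qed

text \<open>Serves to pick good sections arbitrarily close to an endpoint: a null set contains no
  open interval.\<close>

lemma AE_lebesgue_ex_in_interval:
  fixes c d :: real
  assumes "AE x in lebesgue. P x" "c < d"
  shows "\<exists>x. c < x \<and> x < d \<and> P x"
proof (rule ccontr)
  assume "\<not> ?thesis"
  then have "AE x in lebesgue. x \<notin> {c<..<d}" using assms(1) by (rule_tac eventually_mono) auto
  then have "{c<..<d} \<in> null_sets lebesgue" using AE_iff_null_sets[of "{c<..<d}" lebesgue] by auto
  then have "emeasure lborel {c<..<d} = 0" by (simp add: null_sets_def)
  with \<open>c < d\<close> show False by simp
qed

text \<open>Bridge from the Lebesgue integrals of the kernels to the gauge integrals of the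
  differentiation theorem; the added left endpoint is a null set.\<close>

lemma lebesgue_integral_eq_integral_Icc:
  fixes q :: "real \<Rightarrow> real"
  assumes q: "integrable lebesgue q"
  shows "q integrable_on {x..y}"
    and "(LINT t|lebesgue. indicator {x<..y} t * q t) = integral {x..y} q"
proof -
  have ai: "q absolutely_integrable_on {x..y}"
    using q integrable_mult_indicator[OF _ q] by (simp add: set_integrable_def)
  show "q integrable_on {x..y}" by (rule set_lebesgue_integral_eq_integral(1)[OF ai])
  have "integral {x..y} q = (LINT t:{x..y}|lebesgue. q t)"
    by (rule set_lebesgue_integral_eq_integral(2)[OF ai, symmetric])
  also have "\<dots> = (LINT t|lebesgue. indicator {x<..y} t * q t)"
    unfolding set_lebesgue_integral_def
  proof (rule integral_cong_AE)
    have "AE t in lebesgue. t \<noteq> x" using AE_lborel_singleton[of x] by (simp add: AE_lebesgue_iff)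
    then show "AE t in lebesgue. indicator {x..y} t *\<^sub>R q t = indicator {x<..y} t * q t"
      by (rule eventually_mono) (auto simp: indicator_def)
  qed (use q in \<open>auto intro!: borel_measurable_times borel_measurable_indicator\<close>)
  finally show "(LINT t|lebesgue. indicator {x<..y} t * q t) = integral {x..y} q" by simp
qed

text \<open>Vanishing tails make \<open>integral {a..t} q\<close> constant in \<open>t\<close> on
  the open interval, so its derivative, almost everywhere \<open>q\<close>, is 0.\<close>

lemma AE_eq_0_if_tail_integrals_eq_0:
  fixes q :: "real \<Rightarrow> real"
  assumes q: "integrable lebesgue q"
    and tail: "\<And>x. a < x \<Longrightarrow> x < b \<Longrightarrow> (LINT t|lebesgue. indicator {x<..b} t * q t) = 0"
  shows "AE x in lebesgue. a < x \<and> x < b \<longrightarrow> q x = 0"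
proof -
  note qi = lebesgue_integral_eq_integral_Icc(1)[OF q]
  have zero: "integral {x..b} q = 0" if "a < x" "x < b" for x
    using tail[OF that] lebesgue_integral_eq_integral_Icc(2)[OF q] by simp
  have "AE x in lebesgue. x \<notin> {x \<in> {a<..<b}. \<not> ((\<lambda>t. integral {a..t} q) has_real_derivative q x) (at x)}"
    using negligible_not_integral_has_real_derivative[OF qi[of a b]]
    by (intro AE_not_in) (simp add: negligible_iff_null_sets)
  then show ?thesis
  proof (rule eventually_mono, intro impI)
    fix x assume x: "a < x \<and> x < b"
      and "x \<notin> {x \<in> {a<..<b}. \<not> ((\<lambda>t. integral {a..t} q) has_real_derivative q x) (at x)}"
    then have d: "((\<lambda>t. integral {a..t} q) has_real_derivative q x) (at x)" by auto
    have "\<forall>\<^sub>F t in nhds x. t \<in> {a<..<b}" using x by (intro eventually_nhds_in_open) auto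
    then have "\<forall>\<^sub>F t in nhds x. integral {a..t} q = integral {a..b} q"
    proof (rule eventually_mono)
      fix t assume "t \<in> {a<..<b}"
      then show "integral {a..t} q = integral {a..b} q"
        using Henstock_Kurzweil_Integration.integral_combine[of a t b q] qi zero[of t] by auto
    qed
    then have "((\<lambda>t. integral {a..t} q) has_real_derivative 0) (at x)"
      by (subst DERIV_cong_ev[OF refl _ refl, where g = "\<lambda>_. integral {a..b} q"]) auto
    with d show "q x = 0" by (rule DERIV_unique)
  qed
qed

section \<open>Conjugate kernels extended by zero\<close>

text \<open>\<open>K\<close>, \<open>K'\<close> and \<open>w\<close> are the two kernels and the weight, extended by zero. The kernels also vanish
  for \<open>y = a\<close>, since their sections there need not be measurable.\<close>

locale conjugate_pair =
  fixes a b :: real and K K' :: "real \<Rightarrow> real \<Rightarrow> real" and w :: "real \<Rightarrow> real"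
  assumes ab: "a < b"
    and K_meas: "(\<lambda>p. K (fst p) (snd p)) \<in> borel_measurable lebesgue"
    and K'_meas: "(\<lambda>p. K' (fst p) (snd p)) \<in> borel_measurable lebesgue"
    and w_meas: "w \<in> borel_measurable lebesgue"
    and K_pos: "\<And>x y. a < y \<Longrightarrow> y < x \<Longrightarrow> x \<le> b \<Longrightarrow> K x y > 0"
    and K_zero: "\<And>x y. \<not> (a < y \<and> y < x \<and> x \<le> b) \<Longrightarrow> K x y = 0"
    and K'_pos: "\<And>x y. a < y \<Longrightarrow> y < x \<Longrightarrow> x \<le> b \<Longrightarrow> K' x y > 0"
    and K'_zero: "\<And>x y. \<not> (a < y \<and> y < x \<and> x \<le> b) \<Longrightarrow> K' x y = 0"
    and w_pos: "\<And>x. a \<le> x \<Longrightarrow> x \<le> b \<Longrightarrow> w x > 0"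
    and w_zero: "\<And>x. \<not> (a \<le> x \<and> x \<le> b) \<Longrightarrow> w x = 0"
    and conv: "\<And>x y. a < y \<Longrightarrow> y < x \<Longrightarrow> x \<le> b \<Longrightarrow> has_bochner_integral lebesgue (\<lambda>z. K x z * K' z y * w z) 1"
    and conv': "\<And>x y. a < y \<Longrightarrow> y < x \<Longrightarrow> x \<le> b \<Longrightarrow> has_bochner_integral lebesgue (\<lambda>z. K' x z * K z y * w z) 1"
begin

lemma K_nonneg: "0 \<le> K x y" and K'_nonneg: "0 \<le> K' x y" and w_nonneg: "0 \<le> w x"
  using K_pos[of y x] K_zero[of y x] K'_pos[of y x] K'_zero[of y x] w_pos[of x] w_zero[of x] less_imp_le order_refl
  by metis+

text \<open>Fubini yields measurable sections almost everywhere only. Every section of \<open>K\<close> is measurable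
  because the integrand in the conjugacy relation is, and can be divided by a positive measurable
  section of \<open>K'\<close>.\<close>

lemma section_left_meas: "(\<lambda>z. K x z) \<in> borel_measurable lebesgue"
proof (cases "a < x \<and> x \<le> b")
  case True
  have "AE y in lebesgue. (\<lambda>z. K' z y) \<in> borel_measurable lebesgue"
    using AE_section_measurable(2)[OF K'_meas] by simp
  \<comment> \<open>A single \<open>y\<close> recovers \<open>K x z\<close> only for
    \<open>z > y\<close>. The good values \<open>y n\<close> tend to \<open>a\<close>, so each
    \<open>z\<close> above \<open>a\<close> is eventually covered.\<close>
  then have "\<exists>y. a < y \<and> y < a + (x - a) / real (Suc n) \<and> (\<lambda>z. K' z y) \<in> borel_measurable lebesgue" for n
    by (rule AE_lebesgue_ex_in_interval) (use True in simp)
  then obtain y where y: "\<And>n. a < y n" "\<And>n. y n < a + (x - a) / real (Suc n)"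
    "\<And>n. (\<lambda>z. K' z (y n)) \<in> borel_measurable lebesgue"
    by metis
  have ylim: "y \<longlonglongrightarrow> a"
  proof (rule tendsto_sandwich[OF _ _ tendsto_const])
    show "\<forall>\<^sub>F n in sequentially. a \<le> y n" using y(1) by (simp add: less_imp_le)
    show "\<forall>\<^sub>F n in sequentially. y n \<le> a + (x - a) * inverse (real (Suc n))"
      using y(2) by (simp add: less_imp_le divide_inverse)
    have "(\<lambda>n. a + (x - a) * inverse (real (Suc n))) \<longlonglongrightarrow> a + (x - a) * 0"
      by (intro tendsto_intros LIMSEQ_inverse_real_of_nat)
    then show "(\<lambda>n. a + (x - a) * inverse (real (Suc n))) \<longlonglongrightarrow> a" by simp
  qed
  have yx: "y n < x" for n
  proof -
    have "(x - a) / real (Suc n) \<le> (x - a) / 1" using True by (intro divide_left_mono) auto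
    with y(2)[of n] show ?thesis by simp
  qed
  show ?thesis
  proof (rule borel_measurable_LIMSEQ_real)
    fix n
    have "(\<lambda>z. K x z * K' z (y n) * w z) \<in> borel_measurable lebesgue"
      using conv[of "y n" x] y yx True by (auto simp: has_bochner_integral_iff intro: borel_measurable_integrable)
    then show "(\<lambda>z. (K x z * K' z (y n) * w z) / (K' z (y n) * w z)) \<in> borel_measurable lebesgue"
      by (rule borel_measurable_divide[OF _ borel_measurable_times[OF y(3) w_meas]])
  next
    fix z
    show "(\<lambda>n. (K x z * K' z (y n) * w z) / (K' z (y n) * w z)) \<longlonglongrightarrow> K x z"
    proof (cases "a < z \<and> z < x")
      case z: True
      have "\<forall>\<^sub>F n in sequentially. y n < z" using ylim z by (intro order_tendstoD(2)) auto
      then have "\<forall>\<^sub>F n in sequentially. (K x z * K' z (y n) * w z) / (K' z (y n) * w z) = K x z"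
      proof (rule eventually_mono)
        fix n assume "y n < z"
        then have "K' z (y n) > 0" "w z > 0" using z True y(1) by (auto intro!: K'_pos w_pos)
        then show "(K x z * K' z (y n) * w z) / (K' z (y n) * w z) = K x z" by simp
      qed
      then show ?thesis by (rule tendsto_eventually)
    next
      case False
      then have "K x z = 0" by (intro K_zero) auto
      then show ?thesis by simp
    qed
  qed
next
  case False
  then have "K x z = 0" for z by (intro K_zero) auto
  then show ?thesis by simp
qed

text \<open>Mirror image of \<open>section_left_meas\<close>: the product from \<open>conv'\<close>
  is divided by good sections of \<open>K'\<close> at points \<open>x n\<close> that increase to
  \<open>b\<close>.\<close>

lemma section_right_meas: "(\<lambda>z. K z y) \<in> borel_measurable lebesgue"
proof (cases "a < y \<and> y < b")
  case True
  have "AE x in lebesgue. (\<lambda>z. K' x z) \<in> borel_measurable lebesgue"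
    using AE_section_measurable(1)[OF K'_meas] by simp
  then have "\<exists>x. b - (b - y) / real (Suc n) < x \<and> x < b \<and> (\<lambda>z. K' x z) \<in> borel_measurable lebesgue" for n
    by (rule AE_lebesgue_ex_in_interval) (use True in simp)
  then obtain x where x: "\<And>n. b - (b - y) / real (Suc n) < x n" "\<And>n. x n < b"
    "\<And>n. (\<lambda>z. K' (x n) z) \<in> borel_measurable lebesgue"
    by metis
  have xlim: "x \<longlonglongrightarrow> b"
  proof (rule tendsto_sandwich[OF _ _ _ tendsto_const])
    show "\<forall>\<^sub>F n in sequentially. x n \<le> b" using x(2) by (simp add: less_imp_le)
    show "\<forall>\<^sub>F n in sequentially. b - (b - y) * inverse (real (Suc n)) \<le> x n"
      using x(1) by (simp add: less_imp_le divide_inverse)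
    have "(\<lambda>n. b - (b - y) * inverse (real (Suc n))) \<longlonglongrightarrow> b - (b - y) * 0"
      by (intro tendsto_intros LIMSEQ_inverse_real_of_nat)
    then show "(\<lambda>n. b - (b - y) * inverse (real (Suc n))) \<longlonglongrightarrow> b" by simp
  qed
  have yx: "y < x n" for n
  proof -
    have "(b - y) / real (Suc n) \<le> (b - y) / 1" using True by (intro divide_left_mono) auto
    with x(1)[of n] show ?thesis by simp
  qed
  \<comment> \<open>Every \<open>x n\<close> stays below \<open>b\<close>, as the section of
    \<open>K'\<close> at \<open>b\<close> itself may be exceptional. The limit therefore misses the
    value at \<open>z = b\<close>, a single point.\<close>
  let ?L = "\<lambda>z. if z = b then 0 else K z y"
  have "?L \<in> borel_measurable lebesgue"
  proof (rule borel_measurable_LIMSEQ_real)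
    fix n
    have "(\<lambda>z. K' (x n) z * K z y * w z) \<in> borel_measurable lebesgue"
      using conv'[of y "x n"] x(2)[of n] yx[of n] True
      by (auto simp: has_bochner_integral_iff intro: borel_measurable_integrable)
    then show "(\<lambda>z. (K' (x n) z * K z y * w z) / (K' (x n) z * w z)) \<in> borel_measurable lebesgue"
      by (rule borel_measurable_divide[OF _ borel_measurable_times[OF x(3) w_meas]])
  next
    fix z
    show "(\<lambda>n. (K' (x n) z * K z y * w z) / (K' (x n) z * w z)) \<longlonglongrightarrow> ?L z"
    proof (cases "y < z \<and> z < b")
      case z: True
      have "\<forall>\<^sub>F n in sequentially. z < x n" using xlim z by (intro order_tendstoD(1)) auto
      then have "\<forall>\<^sub>F n in sequentially. (K' (x n) z * K z y * w z) / (K' (x n) z * w z) = ?L z"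
      proof (rule eventually_mono)
        fix n assume "z < x n"
        then have "K' (x n) z > 0" "w z > 0" using z True x(2)[of n] by (auto intro!: K'_pos w_pos)
        then show "(K' (x n) z * K z y * w z) / (K' (x n) z * w z) = ?L z" using z by simp
      qed
      then show ?thesis by (rule tendsto_eventually)
    next
      case False
      then have "K' (x n) z * K z y = 0" for n
        using K_zero[of y z] K'_zero[of z "x n"] x(2)[of n] False by (cases "z = b") auto
      moreover have "?L z = 0" using False by (auto intro!: K_zero)
      ultimately show ?thesis by (simp only: mult_zero_left div_0 tendsto_const)
    qed
  qed
  moreover have "AE z in lebesgue. ?L z = K z y"
    using AE_lborel_singleton[of b] unfolding AE_lebesgue_iff by (rule eventually_mono) simp
  ultimately show ?thesis by (rule borel_measurable_AE)
next
  case False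
  then have "K z y = 0" for z by (intro K_zero) auto
  then show ?thesis by simp
qed

text \<open>The products are nonnegative, and they vanish identically unless \<open>y < x\<close>,
  since \<open>z\<close> would have to lie strictly in between. The conditional becomes the
  indicator in \<open>unit_kernel_commutes\<close>.\<close>

lemma conv_nn_integral:
  assumes "a < y"
  shows "x \<le> b \<Longrightarrow> (\<integral>\<^sup>+z. ennreal (K x z * K' z y * w z) \<partial>lebesgue) = (if y < x then 1 else 0)"
    and "x \<le> b \<Longrightarrow> (\<integral>\<^sup>+z. ennreal (K' x z * K z y * w z) \<partial>lebesgue) = (if y < x then 1 else 0)"
proof -
  have z: "K x z * K' z y = 0" "K' x z * K z y = 0" if "\<not> y < x" for z
    using that K_zero[of z x] K'_zero[of y z] K'_zero[of z x] K_zero[of y z] by (cases "z < x"; auto)+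
  show "(\<integral>\<^sup>+z. ennreal (K x z * K' z y * w z) \<partial>lebesgue) = (if y < x then 1 else 0)" if "x \<le> b"
  proof (cases "y < x")
    case True
    with conv[OF assms True that] nn_integral_eq_integral[of lebesgue "\<lambda>z. K x z * K' z y * w z"]
    show ?thesis by (simp add: has_bochner_integral_iff K_nonneg K'_nonneg w_nonneg)
  qed (simp add: z)
  show "(\<integral>\<^sup>+z. ennreal (K' x z * K z y * w z) \<partial>lebesgue) = (if y < x then 1 else 0)" if "x \<le> b"
  proof (cases "y < x")
    case True
    with conv'[OF assms True that] nn_integral_eq_integral[of lebesgue "\<lambda>z. K' x z * K z y * w z"]
    show ?thesis by (simp add: has_bochner_integral_iff K_nonneg K'_nonneg w_nonneg)
  qed (simp add: z)
qed

text \<open>Associativity of the product of kernels, \<open>K (K' K) = (K K') K\<close>, where both products in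
  parentheses are the unit kernel.\<close>

lemma unit_kernel_commutes:
  assumes y: "a < y" and x: "y < x" "x \<le> b"
  shows "(\<integral>\<^sup>+z. ennreal (K x z * w z * indicator {y<..} z) \<partial>lebesgue) =
    (\<integral>\<^sup>+u. ennreal (K u y * w u * indicator {..<x} u) \<partial>lebesgue)"
proof -
  \<comment> \<open>The triple product with intermediate points \<open>z\<close> and
    \<open>u\<close>. Integrating out \<open>u\<close> turns \<open>K'\<close> and the second
    \<open>K\<close> into the unit kernel; integrating out \<open>z\<close> does so with the first
    \<open>K\<close> and \<open>K'\<close>.\<close>
  let ?Q = "\<lambda>p. K x (fst p) * w (fst p) * K' (fst p) (snd p) * (K (snd p) y * w (snd p))"
  have Q: "?Q \<in> borel_measurable lebesgue"
    using borel_measurable_lebesgue_fst_snd(1)[OF section_left_meas[of x]] borel_measurable_lebesgue_fst_snd(1)[OF w_meas]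
      borel_measurable_lebesgue_fst_snd(2)[OF section_right_meas[of y]] borel_measurable_lebesgue_fst_snd(2)[OF w_meas] K'_meas
    by (intro borel_measurable_times)
  have 1: "ennreal (K x z * w z * indicator {y<..} z) = (\<integral>\<^sup>+u. ennreal (?Q (z, u)) \<partial>lebesgue)" for z
  proof (cases "a < z \<and> z < x")
    case True
    then have zb: "z \<le> b" using x by simp
    \<comment> \<open>Measurability is taken from the integrable product, as the section lemmas
      concern \<open>K\<close> and not \<open>K'\<close>.\<close>
    have m: "(\<lambda>u. ennreal (K' z u * K u y * w u)) \<in> borel_measurable lebesgue"
    proof (cases "y < z")
      case True
      then show ?thesis using conv'[OF y True zb]
        by (auto simp: has_bochner_integral_iff dest!: borel_measurable_integrable)
    next
      case False
      then have "K' z u * K u y = 0" for u using K'_zero[of u z] K_zero[of y u] by (cases "u < z") auto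
      then show ?thesis by (simp only: mult_zero_left ennreal_0 measurable_const space_borel iso_tuple_UNIV_I)
    qed
    have "(\<integral>\<^sup>+u. ennreal (?Q (z, u)) \<partial>lebesgue) = (\<integral>\<^sup>+u. ennreal (K x z * w z) * ennreal (K' z u * K u y * w u) \<partial>lebesgue)"
      by (simp add: ennreal_mult[symmetric] K_nonneg K'_nonneg w_nonneg mult.assoc)
    also have "\<dots> = ennreal (K x z * w z) * (\<integral>\<^sup>+u. ennreal (K' z u * K u y * w u) \<partial>lebesgue)"
      by (rule nn_integral_cmult[OF m])
    also have "\<dots> = ennreal (K x z * w z * indicator {y<..} z)"
      by (simp add: conv_nn_integral(2)[OF y zb])
    finally show ?thesis by simp
  next
    case False
    then have "K x z = 0" by (intro K_zero) auto
    then show ?thesis by simp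
  qed
  have 2: "ennreal (K u y * w u * indicator {..<x} u) = (\<integral>\<^sup>+z. ennreal (?Q (z, u)) \<partial>lebesgue)" for u
  proof (cases "y < u \<and> u \<le> b")
    case True
    then have ua: "a < u" using y by simp
    have m: "(\<lambda>z. ennreal (K x z * K' z u * w z)) \<in> borel_measurable lebesgue"
    proof (cases "u < x")
      case True
      then show ?thesis using conv[OF ua True x(2)]
        by (auto simp: has_bochner_integral_iff dest!: borel_measurable_integrable)
    next
      case False
      then have "K x z * K' z u = 0" for z using K_zero[of z x] K'_zero[of u z] by (cases "z < x") auto
      then show ?thesis by (simp only: mult_zero_left ennreal_0 measurable_const space_borel iso_tuple_UNIV_I)
    qed
    have "(\<integral>\<^sup>+z. ennreal (?Q (z, u)) \<partial>lebesgue) = (\<integral>\<^sup>+z. ennreal (K u y * w u) * ennreal (K x z * K' z u * w z) \<partial>lebesgue)"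
      by (simp add: ennreal_mult[symmetric] K_nonneg K'_nonneg w_nonneg mult.assoc mult.commute mult.left_commute)
    also have "\<dots> = ennreal (K u y * w u) * (\<integral>\<^sup>+z. ennreal (K x z * K' z u * w z) \<partial>lebesgue)"
      by (rule nn_integral_cmult[OF m])
    also have "\<dots> = ennreal (K u y * w u * indicator {..<x} u)"
      by (simp add: conv_nn_integral(1)[OF ua x(2)])
    finally show ?thesis by simp
  next
    case False
    then have "K u y = 0" by (intro K_zero) auto
    then show ?thesis by simp
  qed
  have "(\<integral>\<^sup>+z. ennreal (K x z * w z * indicator {y<..} z) \<partial>lebesgue) = (\<integral>\<^sup>+z. \<integral>\<^sup>+u. ennreal (?Q (z, u)) \<partial>lebesgue \<partial>lebesgue)"
    by (simp only: 1)
  also have "\<dots> = (\<integral>\<^sup>+u. \<integral>\<^sup>+z. ennreal (?Q (z, u)) \<partial>lebesgue \<partial>lebesgue)"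
    by (rule lebesgue_Tonelli[OF Q])
  also have "\<dots> = (\<integral>\<^sup>+u. ennreal (K u y * w u * indicator {..<x} u) \<partial>lebesgue)"
    by (simp only: 2)
  finally show ?thesis .
qed

end

section \<open>The section of \<open>K\<close> at \<open>b\<close> and the inversion of
  \<open>K'\<close> up to a constant\<close>

context conjugate_pair
begin

text \<open>The case \<open>x = b\<close> of \<open>unit_kernel_commutes\<close>. The left side is
  the integral behind \<open>delta \<omega> unit_kernel k b y\<close>, the right side an indefinite
  integral in \<open>y\<close>, which can be differentiated.\<close>

lemma nn_integral_kernel_eq_tail:
  assumes "a < y" "y < b"
  shows "(\<integral>\<^sup>+u. ennreal (K u y * w u) \<partial>lebesgue) = (\<integral>\<^sup>+z. ennreal (K b z * w z * indicator {y<..} z) \<partial>lebesgue)"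
proof -
  have "AE u in lebesgue. u \<noteq> b" using AE_lborel_singleton[of b] by (simp add: AE_lebesgue_iff)
  then have "(\<integral>\<^sup>+u. ennreal (K u y * w u) \<partial>lebesgue) = (\<integral>\<^sup>+u. ennreal (K u y * w u * indicator {..<b} u) \<partial>lebesgue)"
    by (intro nn_integral_cong_AE, elim eventually_mono) (auto simp: indicator_def K_zero)
  with unit_kernel_commutes[OF assms order_refl] show ?thesis by simp
qed

text \<open>The essential bound on row integrals may fail at the single row \<open>b\<close>.
  Instead, the tail of that row beyond \<open>y\<close> equals a column integral, bounded by
  \<open>C\<close> for almost every \<open>y\<close>; Fatou's lemma lets such \<open>y\<close> tend
  to \<open>a\<close>.\<close>

lemma integrable_last_section:
  assumes bd: "AE y in lebesgue. (\<integral>\<^sup>+u. ennreal (K u y * w u) \<partial>lebesgue) \<le> ennreal C"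
  shows "integrable lebesgue (\<lambda>z. K b z * w z)"
proof -
  have m: "(\<lambda>z. K b z * w z) \<in> borel_measurable lebesgue"
    by (intro borel_measurable_times section_left_meas w_meas)
  have "\<exists>y. a < y \<and> y < a + (b - a) / real (Suc n) \<and> (\<integral>\<^sup>+u. ennreal (K u y * w u) \<partial>lebesgue) \<le> ennreal C" for n
    by (rule AE_lebesgue_ex_in_interval[OF bd]) (use ab in simp)
  then obtain y where y: "\<And>n. a < y n" "\<And>n. y n < a + (b - a) / real (Suc n)"
    "\<And>n. (\<integral>\<^sup>+u. ennreal (K u (y n) * w u) \<partial>lebesgue) \<le> ennreal C"
    by metis
  have ylim: "y \<longlonglongrightarrow> a"
  proof (rule tendsto_sandwich[OF _ _ tendsto_const])
    show "\<forall>\<^sub>F n in sequentially. a \<le> y n" using y(1) by (simp add: less_imp_le)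
    show "\<forall>\<^sub>F n in sequentially. y n \<le> a + (b - a) * inverse (real (Suc n))"
      using y(2) by (simp add: less_imp_le divide_inverse)
    have "(\<lambda>n. a + (b - a) * inverse (real (Suc n))) \<longlonglongrightarrow> a + (b - a) * 0"
      by (intro tendsto_intros LIMSEQ_inverse_real_of_nat)
    then show "(\<lambda>n. a + (b - a) * inverse (real (Suc n))) \<longlonglongrightarrow> a" by simp
  qed
  have yb: "y n < b" for n
  proof -
    have "(b - a) / real (Suc n) \<le> (b - a) / 1" using ab by (intro divide_left_mono) auto
    with y(2)[of n] show ?thesis by simp
  qed
  let ?f = "\<lambda>n z. ennreal (K b z * w z * indicator {y n<..} z)"
  have lim: "liminf (\<lambda>n. ?f n z) = ennreal (K b z * w z)" for z
  proof (rule lim_imp_Liminf)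
    have "\<forall>\<^sub>F n in sequentially. ?f n z = ennreal (K b z * w z)"
    proof (cases "a < z")
      case True
      then have "\<forall>\<^sub>F n in sequentially. y n < z" using ylim by (intro order_tendstoD(2)) auto
      then show ?thesis by (rule eventually_mono) simp
    next
      case False
      then have "K b z = 0" by (intro K_zero) auto
      then show ?thesis by simp
    qed
    then show "(\<lambda>n. ?f n z) \<longlonglongrightarrow> ennreal (K b z * w z)" by (rule tendsto_eventually)
  qed simp
  have "(\<integral>\<^sup>+z. ennreal (K b z * w z) \<partial>lebesgue) = (\<integral>\<^sup>+z. liminf (\<lambda>n. ?f n z) \<partial>lebesgue)"
    by (simp only: lim)
  also have "\<dots> \<le> liminf (\<lambda>n. integral\<^sup>N lebesgue (?f n))"
    by (intro nn_integral_liminf measurable_compose[OF _ measurable_ennreal] borel_measurable_times[OF m]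
          borel_measurable_indicator) simp
  also have "\<dots> \<le> limsup (\<lambda>n. integral\<^sup>N lebesgue (?f n))"
    by (rule Liminf_le_Limsup) simp
  also have "\<dots> \<le> ennreal C"
    using y(3) nn_integral_kernel_eq_tail[OF y(1) yb] by (intro Limsup_bounded) simp
  also have "\<dots> < \<infinity>" by simp
  finally show ?thesis
    using m by (intro integrableI_nonneg) (simp_all add: K_nonneg w_nonneg)
qed

text \<open>Integrability of the row \<open>b\<close> improves the almost everywhere finiteness of
  the column integrals to every \<open>y\<close> in the open interval, as is required for
  differentiating in \<open>y\<close>.\<close>

lemma kernel_integral_eq_tail:
  assumes y: "a < y" "y < b" and int: "integrable lebesgue (\<lambda>z. K b z * w z)"
  shows "integrable lebesgue (\<lambda>u. K u y * w u)"
    and "(LINT u|lebesgue. K u y * w u) = (LINT z|lebesgue. indicator {y<..} z * (K b z * w z))"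
proof -
  have m: "(\<lambda>u. K u y * w u) \<in> borel_measurable lebesgue"
    by (intro borel_measurable_times section_right_meas w_meas)
  have int': "integrable lebesgue (\<lambda>z. indicator {y<..} z * (K b z * w z))"
    using integrable_mult_indicator[OF _ int, of "{y<..}"] by simp
  have nn: "(\<integral>\<^sup>+u. ennreal (K u y * w u) \<partial>lebesgue) = (\<integral>\<^sup>+z. ennreal (indicator {y<..} z * (K b z * w z)) \<partial>lebesgue)"
    unfolding nn_integral_kernel_eq_tail[OF y] by (simp add: mult.commute)
  also have "\<dots> = ennreal (LINT z|lebesgue. indicator {y<..} z * (K b z * w z))"
    by (rule nn_integral_eq_integral[OF int']) (simp add: K_nonneg w_nonneg)
  finally have eq: "(\<integral>\<^sup>+u. ennreal (K u y * w u) \<partial>lebesgue) = ennreal (LINT z|lebesgue. indicator {y<..} z * (K b z * w z))" .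
  have nn0: "0 \<le> (LINT z|lebesgue. indicator {y<..} z * (K b z * w z))"
    by (rule Bochner_Integration.integral_nonneg) (simp add: K_nonneg w_nonneg)
  show "integrable lebesgue (\<lambda>u. K u y * w u)"
    by (rule integrableI_nonneg[OF m]) (simp_all add: K_nonneg w_nonneg eq)
  show "(LINT u|lebesgue. K u y * w u) = (LINT z|lebesgue. indicator {y<..} z * (K b z * w z))"
    using integral_eq_nn_integral[OF m] eq nn0 by (simp add: K_nonneg w_nonneg)
qed

text \<open>Both sides have the same integral over every tail \<open>(x, b)\<close>: the unit kernel is
  moved past \<open>K\<close> by associativity, then \<open>eq\<close> is inserted and \<open>K\<close> cancels \<open>K'\<close>.\<close>

lemma conjugate_inversion:
  assumes \<eta>: "integrable lebesgue \<eta>" "\<And>y. y > b \<Longrightarrow> \<eta> y = 0"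
    and \<theta>: "integrable lebesgue \<theta>" "\<And>y. y > b \<Longrightarrow> \<theta> y = 0"
    and F: "AE y in lebesgue. (\<integral>\<^sup>+u. ennreal (K u y * w u) \<partial>lebesgue) \<le> ennreal C"
    and G: "AE y in lebesgue. (\<integral>\<^sup>+t. ennreal (K y t * w t) \<partial>lebesgue) \<le> ennreal D"
    and eq: "AE z in lebesgue. a < z \<and> z < b \<longrightarrow>
       (LINT y|lebesgue. \<eta> y * indicator {z<..} y) = (LINT y|lebesgue. K' y z * \<theta> y) - c"
  shows "AE t in lebesgue. a < t \<and> t < b \<longrightarrow>
       w t * (LINT y|lebesgue. K y t * \<eta> y) = \<theta> t - c * (K b t * w t)"
proof -
  note pint = integrable_last_section[OF F]
  have \<eta>m: "\<eta> \<in> borel_measurable lebesgue" and \<theta>m: "\<theta> \<in> borel_measurable lebesgue"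
    using \<eta>(1) \<theta>(1) by (auto intro: borel_measurable_integrable)
  have \<eta>f: "(\<integral>\<^sup>+y. ennreal \<bar>\<eta> y\<bar> \<partial>lebesgue) < \<infinity>" and \<theta>f: "(\<integral>\<^sup>+y. ennreal \<bar>\<theta> y\<bar> \<partial>lebesgue) < \<infinity>"
    using \<eta>(1) \<theta>(1) by (simp_all add: integrable_iff_bounded)
  note kw = K_nonneg K'_nonneg w_nonneg
  define \<Phi> where "\<Phi> t = (LINT y|lebesgue. K y t * \<eta> y * w t)" for t
  let ?Q0 = "\<lambda>p. K (fst p) (snd p) * \<eta> (fst p) * w (snd p)"
  have Q0m: "?Q0 \<in> borel_measurable lebesgue"
    by (intro borel_measurable_times K_meas borel_measurable_lebesgue_fst_snd \<eta>m w_meas)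
  \<comment> \<open>Integrating in \<open>t\<close> first leaves the row integrals of
    \<open>K\<close>, essentially bounded by \<open>D\<close>, against the integrable
    \<open>\<eta>\<close>.\<close>
  have Q0f: "(\<integral>\<^sup>+y. \<integral>\<^sup>+t. ennreal \<bar>?Q0 (y, t)\<bar> \<partial>lebesgue \<partial>lebesgue) < \<infinity>"
  proof -
    have "(\<integral>\<^sup>+y. \<integral>\<^sup>+t. ennreal \<bar>?Q0 (y, t)\<bar> \<partial>lebesgue \<partial>lebesgue) =
        (\<integral>\<^sup>+y. \<integral>\<^sup>+t. ennreal \<bar>\<eta> y\<bar> * ennreal (K y t * w t) \<partial>lebesgue \<partial>lebesgue)"
      by (intro nn_integral_cong) (simp add: ennreal_mult[symmetric] abs_mult kw mult_ac)
    also have "\<dots> = (\<integral>\<^sup>+y. ennreal \<bar>\<eta> y\<bar> * (\<integral>\<^sup>+t. ennreal (K y t * w t) \<partial>lebesgue) \<partial>lebesgue)"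
      by (intro nn_integral_cong nn_integral_cmult measurable_compose[OF _ measurable_ennreal]
            borel_measurable_times section_left_meas w_meas)
    also have "\<dots> \<le> (\<integral>\<^sup>+y. ennreal \<bar>\<eta> y\<bar> * ennreal D \<partial>lebesgue)"
      by (intro nn_integral_mono_AE eventually_mono[OF G] mult_left_mono) auto
    also have "\<dots> = (\<integral>\<^sup>+y. ennreal \<bar>\<eta> y\<bar> \<partial>lebesgue) * ennreal D"
      by (intro nn_integral_multc measurable_compose[OF _ measurable_ennreal] borel_measurable_abs \<eta>m)
    also have "\<dots> < \<infinity>" using \<eta>f by (simp add: ennreal_mult_less_top)
    finally show ?thesis .
  qed
  have \<Phi>_int: "integrable lebesgue \<Phi>"
    using lebesgue_Fubini(2)[OF Q0m Q0f] by (simp add: \<Phi>_def[abs_def])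
  have tails: "(LINT t|lebesgue. \<Phi> t * indicator {x<..} t) =
      (LINT y|lebesgue. \<theta> y * indicator {x<..} y) - c * (LINT z|lebesgue. indicator {x<..} z * (K b z * w z))"
    if x: "a < x" "x < b" for x
  proof -
    note Kx = kernel_integral_eq_tail[OF x pint]
    let ?Q1 = "\<lambda>p. ?Q0 p * indicator {x<..} (snd p)"
    have ind_m: "(\<lambda>p :: real \<times> real. indicator {x<..} (snd p) :: real) \<in> borel_measurable lebesgue"
      by (rule borel_measurable_lebesgue_fst_snd(2)[where f = "indicator {x<..}"]) (auto intro!: borel_measurable_indicator)
    have Q1m: "?Q1 \<in> borel_measurable lebesgue" by (rule borel_measurable_times[OF Q0m ind_m])
    have "(\<integral>\<^sup>+y. \<integral>\<^sup>+t. ennreal \<bar>?Q1 (y, t)\<bar> \<partial>lebesgue \<partial>lebesgue) \<le>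
        (\<integral>\<^sup>+y. \<integral>\<^sup>+t. ennreal \<bar>?Q0 (y, t)\<bar> \<partial>lebesgue \<partial>lebesgue)"
      by (intro nn_integral_mono ennreal_leI) (auto simp: indicator_def)
    also note Q0f
    finally have Q1f: "(\<integral>\<^sup>+y. \<integral>\<^sup>+t. ennreal \<bar>?Q1 (y, t)\<bar> \<partial>lebesgue \<partial>lebesgue) < \<infinity>" .
    define A where "A y = (LINT t|lebesgue. K y t * w t * indicator {x<..} t)" for y
    define B where "B y = (LINT u|lebesgue. K u x * w u * indicator {..<y} u)" for y
    \<comment> \<open>For \<open>x < y \<le> b\<close> this is \<open>unit_kernel_commutes\<close>,
      and for \<open>y \<le> x\<close> both integrals vanish. Beyond \<open>b\<close> they may
      differ, so the factor \<open>\<eta> y = 0\<close> is essential.\<close>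
    have AB: "\<eta> y * A y = \<eta> y * B y" for y
    proof (cases "x < y \<and> y \<le> b")
      case True
      have "A y = enn2real (\<integral>\<^sup>+t. ennreal (K y t * w t * indicator {x<..} t) \<partial>lebesgue)"
        unfolding A_def by (intro integral_eq_nn_integral borel_measurable_times section_left_meas w_meas
            borel_measurable_indicator) (simp_all add: kw)
      also have "\<dots> = enn2real (\<integral>\<^sup>+u. ennreal (K u x * w u * indicator {..<y} u) \<partial>lebesgue)"
        using unit_kernel_commutes[OF x(1)] True by simp
      also have "\<dots> = B y"
        unfolding B_def by (intro integral_eq_nn_integral[symmetric] borel_measurable_times section_right_meas w_meas
            borel_measurable_indicator) (simp_all add: kw)
      finally show ?thesis by simp
    next
      case False
      show ?thesis
      proof (cases "y \<le> b")
        case True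
        with False have "y \<le> x" by auto
        then have "K y t * w t * indicator {x<..} t = 0" "K t x * w t * indicator {..<y} t = 0" for t
          by (auto simp: indicator_def K_zero)
        then show ?thesis by (simp only: A_def B_def)
      qed (simp add: \<eta>(2))
    qed
    let ?Q2 = "\<lambda>p. K (fst p) x * w (fst p) * (\<eta> (snd p) * indicator {p. fst p < snd p} p)"
    have "open {p :: real \<times> real. fst p < snd p}"
      by (intro open_Collect_less continuous_intros)
    then have "(indicator {p :: real \<times> real. fst p < snd p} :: _ \<Rightarrow> real) \<in> borel_measurable lebesgue"
      by (intro borel_measurable_indicator) auto
    then have Q2m: "?Q2 \<in> borel_measurable lebesgue"
      by (intro borel_measurable_times borel_measurable_lebesgue_fst_snd \<eta>m w_meas
          borel_measurable_lebesgue_fst_snd(1)[OF section_right_meas[of x]])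
    \<comment> \<open>Dropping the indicator separates the variables: the bound is the column
      integral of \<open>K\<close> at \<open>x\<close> times the norm of
      \<open>\<eta>\<close>.\<close>
    have Q2f: "(\<integral>\<^sup>+u. \<integral>\<^sup>+y. ennreal \<bar>?Q2 (u, y)\<bar> \<partial>lebesgue \<partial>lebesgue) < \<infinity>"
    proof -
      have "(\<integral>\<^sup>+u. \<integral>\<^sup>+y. ennreal \<bar>?Q2 (u, y)\<bar> \<partial>lebesgue \<partial>lebesgue) \<le>
          (\<integral>\<^sup>+u. \<integral>\<^sup>+y. ennreal (K u x * w u) * ennreal \<bar>\<eta> y\<bar> \<partial>lebesgue \<partial>lebesgue)"
        by (intro nn_integral_mono) (simp add: ennreal_mult[symmetric] abs_mult kw indicator_def)
      also have "\<dots> = (\<integral>\<^sup>+u. ennreal (K u x * w u) * (\<integral>\<^sup>+y. ennreal \<bar>\<eta> y\<bar> \<partial>lebesgue) \<partial>lebesgue)"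
        by (intro nn_integral_cong nn_integral_cmult measurable_compose[OF _ measurable_ennreal]
            borel_measurable_abs \<eta>m)
      also have "\<dots> = (\<integral>\<^sup>+u. ennreal (K u x * w u) \<partial>lebesgue) * (\<integral>\<^sup>+y. ennreal \<bar>\<eta> y\<bar> \<partial>lebesgue)"
        by (intro nn_integral_multc measurable_compose[OF _ measurable_ennreal]
            borel_measurable_integrable[OF Kx(1)])
      also have "\<dots> < \<infinity>"
        using Kx(1) \<eta>f by (simp add: integrable_iff_bounded ennreal_mult_less_top kw)
      finally show ?thesis .
    qed
    let ?Q3 = "\<lambda>p. K' (fst p) (snd p) * \<theta> (fst p) * (K (snd p) x * w (snd p))"
    have Q3m: "?Q3 \<in> borel_measurable lebesgue"
      by (intro borel_measurable_times K'_meas borel_measurable_lebesgue_fst_snd \<theta>m w_meas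
          borel_measurable_lebesgue_fst_snd(2)[OF section_right_meas[of x]])
    have prod0: "K' y u * K u x = 0" if "\<not> (x < y \<and> y \<le> b)" for y u
      using that K_zero[of x u] K'_zero[of u y] by (cases "x < u") auto
    have conv'_y: "has_bochner_integral lebesgue (\<lambda>u. K' y u * K u x * w u) (if x < y \<and> y \<le> b then 1 else 0)" for y
    proof (cases "x < y \<and> y \<le> b")
      case True
      then show ?thesis using conv'[OF x(1), of y] by simp
    next
      case False
      show ?thesis unfolding prod0[OF False] by (simp add: False has_bochner_integral_zero)
    qed
    have conv'_nn: "(\<integral>\<^sup>+u. ennreal (K' y u * K u x * w u) \<partial>lebesgue) \<le> 1" for y
      using nn_integral_eq_integral[of lebesgue "\<lambda>u. K' y u * K u x * w u"] conv'_y[of y]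
      by (simp add: has_bochner_integral_iff kw split: if_splits)
    \<comment> \<open>Conjugacy makes the integral over \<open>u\<close> at most 1, so the double
      integral is dominated by the norm of \<open>\<theta>\<close>.\<close>
    have Q3f: "(\<integral>\<^sup>+y. \<integral>\<^sup>+u. ennreal \<bar>?Q3 (y, u)\<bar> \<partial>lebesgue \<partial>lebesgue) < \<infinity>"
    proof -
      have "(\<integral>\<^sup>+y. \<integral>\<^sup>+u. ennreal \<bar>?Q3 (y, u)\<bar> \<partial>lebesgue \<partial>lebesgue) =
          (\<integral>\<^sup>+y. \<integral>\<^sup>+u. ennreal \<bar>\<theta> y\<bar> * ennreal (K' y u * K u x * w u) \<partial>lebesgue \<partial>lebesgue)"
        by (intro nn_integral_cong) (simp add: ennreal_mult[symmetric] abs_mult kw mult_ac)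
      also have "\<dots> = (\<integral>\<^sup>+y. ennreal \<bar>\<theta> y\<bar> * (\<integral>\<^sup>+u. ennreal (K' y u * K u x * w u) \<partial>lebesgue) \<partial>lebesgue)"
        using conv'_y
        by (intro nn_integral_cong nn_integral_cmult measurable_compose[OF _ measurable_ennreal])
           (auto simp: has_bochner_integral_iff intro: borel_measurable_integrable)
      also have "\<dots> \<le> (\<integral>\<^sup>+y. ennreal \<bar>\<theta> y\<bar> * 1 \<partial>lebesgue)"
        by (intro nn_integral_mono mult_left_mono conv'_nn) auto
      also have "\<dots> < \<infinity>" using \<theta>f by simp
      finally show ?thesis .
    qed
    have Q3y: "(LINT u|lebesgue. ?Q3 (y, u)) = \<theta> y * indicator {x<..} y" for y
    proof -
      have "(LINT u|lebesgue. ?Q3 (y, u)) = (LINT u|lebesgue. \<theta> y * (K' y u * K u x * w u))"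
        by (simp add: mult_ac)
      also have "\<dots> = \<theta> y * (LINT u|lebesgue. K' y u * K u x * w u)" by simp
      also have "\<dots> = \<theta> y * indicator {x<..} y"
        using conv'_y[of y] \<theta>(2)[of y] by (cases "y \<le> b") (auto simp: has_bochner_integral_iff)
      finally show ?thesis .
    qed
    have Q3u: "(LINT y|lebesgue. ?Q3 (y, u)) = K u x * w u * (LINT y|lebesgue. K' y u * \<theta> y)" for u
      by (simp add: mult.commute)
    have "(LINT t|lebesgue. \<Phi> t * indicator {x<..} t) = (LINT t|lebesgue. LINT y|lebesgue. ?Q1 (y, t))"
      by (simp add: \<Phi>_def)
    also have "\<dots> = (LINT y|lebesgue. LINT t|lebesgue. ?Q1 (y, t))"
      by (rule lebesgue_Fubini(3)[OF Q1m Q1f, symmetric])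
    also have "\<dots> = (LINT y|lebesgue. \<eta> y * A y)"
    proof -
      have "(LINT t|lebesgue. ?Q1 (y, t)) = (LINT t|lebesgue. \<eta> y * (K y t * w t * indicator {x<..} t))" for y
        by (simp add: mult_ac)
      then show ?thesis by (simp add: A_def)
    qed
    also have "\<dots> = (LINT y|lebesgue. \<eta> y * B y)" by (simp only: AB)
    also have "\<dots> = (LINT y|lebesgue. LINT u|lebesgue. ?Q2 (u, y))"
    proof -
      have "(LINT u|lebesgue. ?Q2 (u, y)) = (LINT u|lebesgue. \<eta> y * (K u x * w u * indicator {..<y} u))" for y
        by (intro Bochner_Integration.integral_cong) (auto simp: indicator_def)
      then show ?thesis by (simp add: B_def)
    qed
    also have "\<dots> = (LINT u|lebesgue. LINT y|lebesgue. ?Q2 (u, y))"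
      by (rule lebesgue_Fubini(3)[OF Q2m Q2f, symmetric])
    also have "\<dots> = (LINT u|lebesgue. (LINT y|lebesgue. ?Q3 (y, u)) - c * (K u x * w u))"
    proof (rule integral_cong_AE)
      show "(\<lambda>u. LINT y|lebesgue. ?Q2 (u, y)) \<in> borel_measurable lebesgue"
        by (rule borel_measurable_integrable[OF lebesgue_Fubini(1)[OF Q2m Q2f]])
      show "(\<lambda>u. (LINT y|lebesgue. ?Q3 (y, u)) - c * (K u x * w u)) \<in> borel_measurable lebesgue"
        by (intro borel_measurable_diff borel_measurable_integrable[OF lebesgue_Fubini(2)[OF Q3m Q3f]]
            borel_measurable_times borel_measurable_const section_right_meas w_meas)
      \<comment> \<open>The relation \<open>eq\<close> covers \<open>a < u < b\<close>. Elsewhere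
        \<open>K u x\<close> vanishes, except at the single point \<open>u = b\<close>, which is
        discarded.\<close>
      have "AE u in lebesgue. u \<noteq> b" using AE_lborel_singleton[of b] by (simp add: AE_lebesgue_iff)
      with eq show "AE u in lebesgue. (LINT y|lebesgue. ?Q2 (u, y)) = (LINT y|lebesgue. ?Q3 (y, u)) - c * (K u x * w u)"
      proof eventually_elim
        case (elim u)
        have "(LINT y|lebesgue. ?Q2 (u, y)) = (LINT y|lebesgue. K u x * w u * (\<eta> y * indicator {u<..} y))"
          by (intro Bochner_Integration.integral_cong) (auto simp: indicator_def)
        also have "\<dots> = K u x * w u * (LINT y|lebesgue. \<eta> y * indicator {u<..} y)" by simp
        also have "\<dots> = K u x * w u * ((LINT y|lebesgue. K' y u * \<theta> y) - c)"
        proof (cases "x < u \<and> u \<le> b")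
          case True
          with elim x show ?thesis by simp
        next
          case False
          then have "K u x = 0" by (intro K_zero) auto
          then show ?thesis by simp
        qed
        finally show ?case unfolding Q3u by (simp add: algebra_simps)
      qed
    qed
    also have "\<dots> = (LINT u|lebesgue. LINT y|lebesgue. ?Q3 (y, u)) - (LINT u|lebesgue. c * (K u x * w u))"
      by (rule Bochner_Integration.integral_diff[OF lebesgue_Fubini(2)[OF Q3m Q3f]])
         (rule integrable_mult_right, rule Kx(1))
    also have "(LINT u|lebesgue. LINT y|lebesgue. ?Q3 (y, u)) = (LINT y|lebesgue. LINT u|lebesgue. ?Q3 (y, u))"
      by (rule lebesgue_Fubini(3)[OF Q3m Q3f, symmetric])
    also have "\<dots> = (LINT y|lebesgue. \<theta> y * indicator {x<..} y)" by (simp only: Q3y)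
    also have "(LINT u|lebesgue. c * (K u x * w u)) = c * (LINT z|lebesgue. indicator {x<..} z * (K b z * w z))"
      unfolding Kx(2)[symmetric] by simp
    finally show ?thesis .
  qed
  \<comment> \<open>The difference of the two sides of the claim; \<open>tails\<close> says that its
    tail integrals vanish.\<close>
  define q where "q t = \<Phi> t - \<theta> t + c * (K b t * w t)" for t
  have q_int: "integrable lebesgue q"
    unfolding q_def[abs_def]
    by (intro Bochner_Integration.integrable_add Bochner_Integration.integrable_diff \<Phi>_int \<theta>(1) integrable_mult_right pint)
  have "(LINT t|lebesgue. indicator {x<..b} t * q t) = 0" if x: "a < x" "x < b" for x
  proof -
    have tl: "integrable lebesgue (\<lambda>t. f t * indicator {x<..} t)" if "integrable lebesgue f" for f :: "real \<Rightarrow> real"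
      using integrable_mult_indicator[OF _ that, of "{x<..}"] by (simp add: mult.commute)
    have tl': "integrable lebesgue (\<lambda>t. c * (indicator {x<..} t * (K b t * w t)))"
      using tl[OF pint] by (intro integrable_mult_right) (simp add: mult.commute)
    have "indicator {x<..b} t * q t =
        \<Phi> t * indicator {x<..} t - \<theta> t * indicator {x<..} t + c * (indicator {x<..} t * (K b t * w t))" for t
    proof (cases "t \<le> b")
      case False
      then have "w t = 0" by (intro w_zero) auto
      with False show ?thesis using \<theta>(2)[of t] by (simp add: q_def \<Phi>_def)
    qed (auto simp: indicator_def q_def)
    then have "(LINT t|lebesgue. indicator {x<..b} t * q t) = (LINT t|lebesgue. 
        \<Phi> t * indicator {x<..} t - \<theta> t * indicator {x<..} t + c * (indicator {x<..} t * (K b t * w t)))"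
      by (simp only:)
    also have "\<dots> = (LINT t|lebesgue. \<Phi> t * indicator {x<..} t) - (LINT t|lebesgue. \<theta> t * indicator {x<..} t)
        + c * (LINT z|lebesgue. indicator {x<..} z * (K b z * w z))"
      using tl[OF \<Phi>_int] tl[OF \<theta>(1)] tl' by simp
    finally show ?thesis using tails[OF x] by simp
  qed
  then have "AE x in lebesgue. a < x \<and> x < b \<longrightarrow> q x = 0"
    by (rule AE_eq_0_if_tail_integrals_eq_0[OF q_int])
  then show ?thesis
    by (rule eventually_mono) (auto simp: q_def \<Phi>_def mult.commute)
qed

end

section \<open>Inversion of the right-sided derivative\<close>

definition extend_kernel :: "real \<Rightarrow> real \<Rightarrow> (real \<Rightarrow> real \<Rightarrow> real) \<Rightarrow> real \<Rightarrow> real \<Rightarrow> real" where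
  "extend_kernel a b k x y = (if a < y \<and> y < x \<and> x \<le> b then k x y else 0)"

definition extend_weight :: "real \<Rightarrow> real \<Rightarrow> (real \<Rightarrow> real) \<Rightarrow> real \<Rightarrow> real" where
  "extend_weight a b \<omega> x = (if x \<in> {a..b} then \<omega> x else 0)"

lemma extend_weight_meas:
  assumes "weight a b \<omega>"
  shows "extend_weight a b \<omega> \<in> borel_measurable lebesgue"
proof -
  have "\<omega> \<in> borel_measurable (lebesgue_on {a..b})"
    using assms by (simp add: weight_def Linfty_def)
  then show ?thesis
    unfolding extend_weight_def[abs_def] by (intro borel_measurable_if_I) auto
qed

lemma extend_kernel_meas:
  assumes "k \<in> kernels a b \<omega>"
  shows "(\<lambda>p. extend_kernel a b k (fst p) (snd p)) \<in> borel_measurable lebesgue"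
proof -
  let ?S = "{p :: real \<times> real. a < snd p} \<inter> {p. snd p < fst p} \<inter> {p. fst p \<le> b}"
  have "open {p :: real \<times> real. a < snd p}" "open {p :: real \<times> real. snd p < fst p}"
    "closed {p :: real \<times> real. fst p \<le> b}"
    by (intro open_Collect_less closed_Collect_le continuous_intros)+
  then have "?S \<in> sets borel" by (intro sets.Int borel_open borel_closed)
  then have S: "?S \<in> sets lebesgue" by simp
  have "(\<lambda>(x, y). k x y) \<in> borel_measurable (lebesgue_on (Omega a b))"
    using assms by (simp add: kernels_def)
  then have "(\<lambda>(x, y). k x y) \<in> borel_measurable (lebesgue_on ?S)"
    by (rule measurable_restrict_mono) (auto simp: Omega_def)
  then have "(\<lambda>p. if p \<in> ?S then (\<lambda>(x, y). k x y) p else 0) \<in> borel_measurable lebesgue"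
    by (rule borel_measurable_if_I[OF _ S])
  also have "(\<lambda>p. if p \<in> ?S then (\<lambda>(x, y). k x y) p else 0) = (\<lambda>p. extend_kernel a b k (fst p) (snd p))"
    by (auto simp: extend_kernel_def fun_eq_iff)
  finally show ?thesis .
qed

text \<open>Integrability comes from the value: a function that is not integrable has Bochner
  integral 0, not 1.\<close>

lemma has_bochner_integral_extend_kernels:
  assumes xy: "a < y" "y < x" "x \<le> b" and delta: "delta \<omega> k1 k2 x y = 1"
  shows "has_bochner_integral lebesgue
    (\<lambda>z. extend_kernel a b k1 x z * extend_kernel a b k2 z y * extend_weight a b \<omega> z) 1"
proof -
  have "delta \<omega> k1 k2 x y = (LINT z|lebesgue. indicator {y<..<x} z *\<^sub>R (k1 x z * k2 z y * \<omega> z))"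
    unfolding delta_def by (rule integral_restrict_space) simp
  also have "(\<lambda>z. indicator {y<..<x} z *\<^sub>R (k1 x z * k2 z y * \<omega> z)) =
      (\<lambda>z. extend_kernel a b k1 x z * extend_kernel a b k2 z y * extend_weight a b \<omega> z)"
    using xy by (auto simp: fun_eq_iff indicator_def extend_kernel_def extend_weight_def)
  finally have 1: "(LINT z|lebesgue. extend_kernel a b k1 x z * extend_kernel a b k2 z y * extend_weight a b \<omega> z) = 1"
    using delta by simp
  then have "integrable lebesgue (\<lambda>z. extend_kernel a b k1 x z * extend_kernel a b k2 z y * extend_weight a b \<omega> z)"
    using not_integrable_integral_eq zero_neq_one by metis
  with 1 show ?thesis by (simp add: has_bochner_integral_iff)
qed

lemma kernels_nonneg:
  assumes "weight a b \<omega>" "k \<in> kernels a b \<omega>" "a \<le> y" "y < x" "x \<le> b" "z \<in> {a..b}"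
  shows "0 \<le> k x y * \<omega> z"
proof -
  have "(x, y) \<in> Omega a b" using assms by (auto simp: Omega_def)
  then have "k x y > 0" using assms(2) unfolding kernels_def by auto
  moreover have "\<omega> z > 0" using assms by (auto simp: weight_def)
  ultimately show ?thesis by simp
qed

text \<open>The integrability clause of \<open>kernels\<close> excludes the default 0 almost
  everywhere, so that the bound on the Bochner integral \<open>F_int\<close> bounds the nonnegative
  integral.\<close>

lemma F_kernel_bounded:
  assumes w: "weight a b \<omega>" and k: "k \<in> kernels a b \<omega>"
  obtains C where "AE y in lebesgue. (\<integral>\<^sup>+u. ennreal (extend_kernel a b k u y * extend_weight a b \<omega> u) \<partial>lebesgue) \<le> ennreal C"
proof -
  obtain C where "AE y in lebesgue_on {a..<b}. integrable (lebesgue_on {y<..b}) (\<lambda>x. k x y * \<omega> x)"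
    "AE y in lebesgue_on {a..<b}. \<bar>F_int b \<omega> k y\<bar> \<le> C"
    using k by (auto simp: kernels_def Linfty_def)
  then have "AE y in lebesgue. y \<in> {a..<b} \<longrightarrow> integrable (lebesgue_on {y<..b}) (\<lambda>x. k x y * \<omega> x)"
    "AE y in lebesgue. y \<in> {a..<b} \<longrightarrow> \<bar>F_int b \<omega> k y\<bar> \<le> C"
    by (simp_all add: AE_restrict_space_iff)
  then have "AE y in lebesgue. (\<integral>\<^sup>+u. ennreal (extend_kernel a b k u y * extend_weight a b \<omega> u) \<partial>lebesgue) \<le> ennreal C"
  proof eventually_elim
    case (elim y)
    show ?case
    proof (cases "a < y \<and> y < b")
      case True
      have "(\<integral>\<^sup>+u. ennreal (extend_kernel a b k u y * extend_weight a b \<omega> u) \<partial>lebesgue) =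
          (\<integral>\<^sup>+u. ennreal (k u y * \<omega> u) * indicator {y<..b} u \<partial>lebesgue)"
        using True by (intro nn_integral_cong) (auto simp: extend_kernel_def extend_weight_def indicator_def)
      also have "\<dots> = (\<integral>\<^sup>+u. ennreal (k u y * \<omega> u) \<partial>lebesgue_on {y<..b})"
        by (rule nn_integral_restrict_space[symmetric]) simp
      also have "\<dots> = ennreal (F_int b \<omega> k y)"
        unfolding F_int_def
        by (rule nn_integral_eq_integral) (use True elim in \<open>auto intro!: AE_I2 kernels_nonneg[OF w k]\<close>)
      also have "\<dots> \<le> ennreal C" using True elim by (intro ennreal_leI) auto
      finally show ?thesis .
    next
      case False
      then have "extend_kernel a b k u y = 0" for u by (auto simp: extend_kernel_def)
      then show ?thesis by simp
    qed
  qed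
  then show ?thesis by (rule that)
qed

lemma G_kernel_bounded:
  assumes w: "weight a b \<omega>" and k: "k \<in> kernels a b \<omega>"
  obtains C where "AE y in lebesgue. (\<integral>\<^sup>+t. ennreal (extend_kernel a b k y t * extend_weight a b \<omega> t) \<partial>lebesgue) \<le> ennreal C"
proof -
  obtain C where "AE y in lebesgue_on {a<..b}. integrable (lebesgue_on {a..<y}) (\<lambda>x. k y x * \<omega> x)"
    "AE y in lebesgue_on {a<..b}. \<bar>G_int a \<omega> k y\<bar> \<le> C"
    using k by (auto simp: kernels_def Linfty_def)
  then have "AE y in lebesgue. y \<in> {a<..b} \<longrightarrow> integrable (lebesgue_on {a..<y}) (\<lambda>x. k y x * \<omega> x)"
    "AE y in lebesgue. y \<in> {a<..b} \<longrightarrow> \<bar>G_int a \<omega> k y\<bar> \<le> C"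
    by (simp_all add: AE_restrict_space_iff)
  then have "AE y in lebesgue. (\<integral>\<^sup>+t. ennreal (extend_kernel a b k y t * extend_weight a b \<omega> t) \<partial>lebesgue) \<le> ennreal C"
  proof eventually_elim
    case (elim y)
    show ?case
    proof (cases "a < y \<and> y \<le> b")
      case True
      \<comment> \<open>Only an inequality, because \<open>extend_kernel\<close> drops the point
        \<open>t = a\<close> that belongs to the range of \<open>G_int\<close>.\<close>
      have "(\<integral>\<^sup>+t. ennreal (extend_kernel a b k y t * extend_weight a b \<omega> t) \<partial>lebesgue) \<le>
          (\<integral>\<^sup>+t. ennreal (k y t * \<omega> t) * indicator {a..<y} t \<partial>lebesgue)"
        using True by (intro nn_integral_mono) (auto simp: extend_kernel_def extend_weight_def indicator_def)
      also have "\<dots> = (\<integral>\<^sup>+t. ennreal (k y t * \<omega> t) \<partial>lebesgue_on {a..<y})"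
        by (rule nn_integral_restrict_space[symmetric]) simp
      also have "\<dots> = ennreal (G_int a \<omega> k y)"
        unfolding G_int_def
        by (rule nn_integral_eq_integral) (use True elim in \<open>auto intro!: AE_I2 kernels_nonneg[OF w k]\<close>)
      also have "\<dots> \<le> ennreal C" using True elim by (intro ennreal_leI) auto
      finally show ?thesis .
    next
      case False
      then have "extend_kernel a b k y t = 0" for t by (auto simp: extend_kernel_def)
      then show ?thesis by simp
    qed
  qed
  then show ?thesis by (rule that)
qed

lemma conjugate_pair_extend:
  assumes ab: "a < b" and w: "weight a b \<omega>" and c: "conjugate a b \<omega> k k'"
  shows "conjugate_pair a b (extend_kernel a b k) (extend_kernel a b k') (extend_weight a b \<omega>)"
proof
  have k: "k \<in> kernels a b \<omega>" "k' \<in> kernels a b \<omega>" using c by (auto simp: conjugate_def)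
  have pos: "k1 x y > 0" if "k1 \<in> kernels a b \<omega>" "a < y" "y < x" "x \<le> b" for k1 x y
  proof -
    have "(x, y) \<in> Omega a b" using that by (auto simp: Omega_def)
    then show ?thesis using that(1) unfolding kernels_def by auto
  qed
  show "a < b" by fact
  show "(\<lambda>p. extend_kernel a b k (fst p) (snd p)) \<in> borel_measurable lebesgue"
    "(\<lambda>p. extend_kernel a b k' (fst p) (snd p)) \<in> borel_measurable lebesgue"
    by (rule extend_kernel_meas[OF k(1)], rule extend_kernel_meas[OF k(2)])
  show "extend_weight a b \<omega> \<in> borel_measurable lebesgue" by (rule extend_weight_meas[OF w])
  fix x y
  show "extend_kernel a b k x y = 0" "extend_kernel a b k' x y = 0" if "\<not> (a < y \<and> y < x \<and> x \<le> b)"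
    using that by (auto simp: extend_kernel_def)
  show "extend_weight a b \<omega> x > 0" if "a \<le> x" "x \<le> b"
    using w that by (auto simp: extend_weight_def weight_def)
  show "extend_weight a b \<omega> x = 0" if "\<not> (a \<le> x \<and> x \<le> b)"
    using that by (auto simp: extend_weight_def)
  assume xy: "a < y" "y < x" "x \<le> b"
  then show "extend_kernel a b k x y > 0" "extend_kernel a b k' x y > 0"
    using pos[OF k(1) xy] pos[OF k(2) xy] by (auto simp: extend_kernel_def)
  have "(x, y) \<in> Omega a b" using xy by (auto simp: Omega_def)
  then have "delta \<omega> k k' x y = 1" "delta \<omega> k' k x y = 1" using c unfolding conjugate_def by auto
  then show "has_bochner_integral lebesgue
      (\<lambda>z. extend_kernel a b k x z * extend_kernel a b k' z y * extend_weight a b \<omega> z) 1"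
    "has_bochner_integral lebesgue
      (\<lambda>z. extend_kernel a b k' x z * extend_kernel a b k z y * extend_weight a b \<omega> z) 1"
    by (auto intro: has_bochner_integral_extend_kernels[OF xy])
qed

section \<open>The integrals and derivatives of the theorem in terms of the extended
  functions\<close>

lemma right_integral_eq:
  assumes "a < x"
  shows "right_integral b \<omega> k f x =
    (LINT y|lebesgue. extend_kernel a b k y x * (indicator {a..b} y * (f y * \<omega> y)))"
proof -
  have "right_integral b \<omega> k f x = (LINT y|lebesgue. indicator {x<..b} y *\<^sub>R (k y x * f y * \<omega> y))"
    unfolding right_integral_def by (rule integral_restrict_space) simp
  also have "(\<lambda>y. indicator {x<..b} y *\<^sub>R (k y x * f y * \<omega> y)) =
      (\<lambda>y. extend_kernel a b k y x * (indicator {a..b} y * (f y * \<omega> y)))"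
    using assms by (auto simp: fun_eq_iff indicator_def extend_kernel_def)
  finally show ?thesis .
qed

lemma delta_unit_kernel_eq:
  assumes "a < x" "x < b" and m: "(\<lambda>u. extend_kernel a b k u x * extend_weight a b \<omega> u) \<in> borel_measurable lebesgue"
  shows "delta \<omega> unit_kernel k b x = (LINT u|lebesgue. extend_kernel a b k u x * extend_weight a b \<omega> u)"
proof -
  have "AE u in lebesgue. u \<noteq> b" using AE_lborel_singleton[of b] by (simp add: AE_lebesgue_iff)
  then have ae: "AE u in lebesgue. extend_kernel a b k u x * extend_weight a b \<omega> u =
      indicator {x<..<b} u *\<^sub>R (unit_kernel b u * k u x * \<omega> u)"
    using assms by (elim eventually_mono) (auto simp: indicator_def extend_kernel_def extend_weight_def unit_kernel_def)
  have "delta \<omega> unit_kernel k b x = (LINT u|lebesgue. indicator {x<..<b} u *\<^sub>R (unit_kernel b u * k u x * \<omega> u))"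
    unfolding delta_def by (rule integral_restrict_space) simp
  also have "\<dots> = (LINT u|lebesgue. extend_kernel a b k u x * extend_weight a b \<omega> u)"
    using ae borel_measurable_AE[OF m ae] m by (intro integral_cong_AE) (auto elim: eventually_mono)
  finally show ?thesis .
qed

text \<open>\<open>g\<close> is an indefinite integral, so its density equals \<open>deriv g\<close>
  almost everywhere. Where \<open>g\<close> is not differentiable \<open>deriv g\<close> is
  arbitrary, and at the endpoints it depends on values of \<open>g\<close> outside the interval;
  these points form a null set.\<close>

lemma abs_cont_on_deriv:
  assumes ab: "a < b" and g: "abs_cont_on a b g"
  shows "integrable lebesgue (\<lambda>x. indicator {a..b} x * deriv g x)"
    and "\<And>x. x \<in> {a..b} \<Longrightarrow> (LINT t|lebesgue. indicator {a..b} t * deriv g t * indicator {x<..} t) = g b - g x"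
proof -
  obtain h where h: "h absolutely_integrable_on {a..b}"
    and hi: "\<And>x. x \<in> {a..b} \<Longrightarrow> (h has_integral (g x - g a)) {a..x}"
    using abs_cont_on_imp_integral[OF assms] by metis
  have h_on: "h integrable_on {a..b}" using hi[of b] ab by auto
  have "AE x in lebesgue. x \<notin> {x \<in> {a<..<b}. \<not> ((\<lambda>t. integral {a..t} h) has_real_derivative h x) (at x)}"
    using negligible_not_integral_has_real_derivative[OF h_on]
    by (intro AE_not_in) (simp add: negligible_iff_null_sets)
  moreover have "AE x in lebesgue. x \<noteq> a" "AE x in lebesgue. x \<noteq> b"
    using AE_lborel_singleton[of a] AE_lborel_singleton[of b] by (simp_all add: AE_lebesgue_iff)
  ultimately have ae: "AE x in lebesgue. indicator {a..b} x * h x = indicator {a..b} x * deriv g x"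
  proof eventually_elim
    case (elim x)
    show ?case
    proof (cases "x \<in> {a<..<b}")
      case True
      then have d: "((\<lambda>t. g a + integral {a..t} h) has_real_derivative h x) (at x)"
        using elim by (auto intro!: derivative_eq_intros)
      have "\<forall>\<^sub>F t in nhds x. t \<in> {a<..<b}" using True by (intro eventually_nhds_in_open) auto
      then have "\<forall>\<^sub>F t in nhds x. g t = g a + integral {a..t} h"
      proof (rule eventually_mono)
        fix t assume "t \<in> {a<..<b}"
        then show "g t = g a + integral {a..t} h" using hi[of t] by (auto dest: integral_unique)
      qed
      then have "(g has_real_derivative h x) (at x)"
        using d by (subst DERIV_cong_ev[OF refl _ refl, where g = "\<lambda>t. g a + integral {a..t} h"]) auto
      then show ?thesis by (simp add: DERIV_imp_deriv)
    qed (use elim in auto)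
  qed
  have int: "integrable lebesgue (\<lambda>x. indicator {a..b} x * h x)"
    using h by (simp add: set_integrable_def)
  have m: "(\<lambda>x. indicator {a..b} x * deriv g x) \<in> borel_measurable lebesgue"
    by (rule borel_measurable_AE[OF borel_measurable_integrable[OF int] ae])
  show "integrable lebesgue (\<lambda>x. indicator {a..b} x * deriv g x)"
    by (rule integrable_cong_AE_imp[OF int m]) (use ae in \<open>auto elim: eventually_mono\<close>)
  fix x assume x: "x \<in> {a..b}"
  have "(LINT t|lebesgue. indicator {a..b} t * deriv g t * indicator {x<..} t) =
      (LINT t|lebesgue. indicator {x<..b} t * (indicator {a..b} t * h t))"
  proof (rule integral_cong_AE)
    show "(\<lambda>t. indicator {a..b} t * deriv g t * indicator {x<..} t) \<in> borel_measurable lebesgue"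
      by (rule borel_measurable_times[OF m]) (auto intro!: borel_measurable_indicator)
    show "(\<lambda>t. indicator {x<..b} t * (indicator {a..b} t * h t)) \<in> borel_measurable lebesgue"
      by (rule borel_measurable_times[OF _ borel_measurable_integrable[OF int]])
         (auto intro!: borel_measurable_indicator)
    show "AE t in lebesgue. indicator {a..b} t * deriv g t * indicator {x<..} t = indicator {x<..b} t * (indicator {a..b} t * h t)"
      using ae by (rule eventually_mono) (auto simp: indicator_def)
  qed
  also have "\<dots> = integral {x..b} (\<lambda>t. indicator {a..b} t * h t)"
    by (rule lebesgue_integral_eq_integral_Icc(2)[OF int])
  also have "\<dots> = integral {x..b} h"
    using x by (intro Henstock_Kurzweil_Integration.integral_cong) auto
  also have "\<dots> = g b - g x"
    using Henstock_Kurzweil_Integration.integral_combine[of a x b h] x h_on hi[of x] hi[of b] ab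
    by (auto dest!: integral_unique)
  finally show "(LINT t|lebesgue. indicator {a..b} t * deriv g t * indicator {x<..} t) = g b - g x" .
qed

theorem theorem4p11:
  fixes a b :: real and \<omega> f :: "real \<Rightarrow> real" and k k' :: "real \<Rightarrow> real \<Rightarrow> real"
  assumes "a < b"
    and "weight a b \<omega>"
    and "k' \<in> kernels a b \<omega>"
    and "k \<in> conj_kernels a b \<omega> k'"
    and "integrable (lebesgue_on {a..b}) f"
    and "has_ac_rep a b (right_integral b \<omega> k' f)"
  shows "AE x in lebesgue_on {a..b}.
    (\<lambda>t. delta \<omega> unit_kernel k b t) differentiable at x \<and>
    right_integral b \<omega> k (right_derivative a b \<omega> k' f) x =
      f x + ac_rep a b (right_integral b \<omega> k' f) b *
        (1 / \<omega> x * deriv (\<lambda>t. delta \<omega> unit_kernel k b t) x)"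
proof -
  define K where "K = extend_kernel a b k"
  define K' where "K' = extend_kernel a b k'"
  define w where "w = extend_weight a b \<omega>"
  define g where "g = ac_rep a b (right_integral b \<omega> k' f)"
  have k: "k \<in> kernels a b \<omega>" and conj: "conjugate a b \<omega> k k'"
    using assms(4) by (auto simp: conj_kernels_def)
  interpret conjugate_pair a b K K' w
    unfolding K_def K'_def w_def by (rule conjugate_pair_extend[OF assms(1,2) conj])
  obtain C where F: "AE y in lebesgue. (\<integral>\<^sup>+u. ennreal (K u y * w u) \<partial>lebesgue) \<le> ennreal C"
    unfolding K_def w_def by (rule F_kernel_bounded[OF assms(2) k])
  obtain D where G: "AE y in lebesgue. (\<integral>\<^sup>+t. ennreal (K y t * w t) \<partial>lebesgue) \<le> ennreal D"
    unfolding K_def w_def by (rule G_kernel_bounded[OF assms(2) k])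
  define p where "p z = K b z * w z" for z
  have p: "integrable lebesgue p"
    unfolding p_def[abs_def] by (rule integrable_last_section[OF F])
  \<comment> \<open>Valid at every point of the open interval: a derivative at \<open>x\<close>
    needs the formula in a whole neighbourhood of \<open>x\<close>.\<close>
  have delta: "delta \<omega> unit_kernel k b x = integral {x..b} p" if x: "a < x" "x < b" for x
  proof -
    have "delta \<omega> unit_kernel k b x = (LINT u|lebesgue. K u x * w u)"
      unfolding K_def w_def
      by (rule delta_unit_kernel_eq[OF x], fold K_def w_def) (intro borel_measurable_times section_right_meas w_meas)
    also have "\<dots> = (LINT z|lebesgue. indicator {x<..} z * p z)"
      unfolding p_def by (rule kernel_integral_eq_tail(2)[OF x]) (use p in \<open>simp add: p_def[abs_def]\<close>)
    also have "\<dots> = (LINT z|lebesgue. indicator {x<..b} z * p z)"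
      by (intro Bochner_Integration.integral_cong) (auto simp: indicator_def p_def w_zero)
    also have "\<dots> = integral {x..b} p" by (rule lebesgue_integral_eq_integral_Icc(2)[OF p])
    finally show ?thesis .
  qed
  note p_on = lebesgue_integral_eq_integral_Icc(1)[OF p]
  have "AE x in lebesgue. x \<notin> {x \<in> {a<..<b}. \<not> ((\<lambda>t. integral {a..t} p) has_real_derivative p x) (at x)}"
    using negligible_not_integral_has_real_derivative[OF p_on[of a b]]
    by (intro AE_not_in) (simp add: negligible_iff_null_sets)
  then have deriv_delta: "AE x in lebesgue. a < x \<and> x < b \<longrightarrow>
      ((\<lambda>t. delta \<omega> unit_kernel k b t) has_real_derivative - p x) (at x)"
  proof (rule eventually_mono, intro impI)
    fix x assume x: "a < x \<and> x < b"
      and "x \<notin> {x \<in> {a<..<b}. \<not> ((\<lambda>t. integral {a..t} p) has_real_derivative p x) (at x)}"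
    then have d: "((\<lambda>t. integral {a..b} p - integral {a..t} p) has_real_derivative - p x) (at x)"
      by (auto intro!: derivative_eq_intros)
    have "\<forall>\<^sub>F t in nhds x. t \<in> {a<..<b}" using x by (intro eventually_nhds_in_open) auto
    then have "\<forall>\<^sub>F t in nhds x. delta \<omega> unit_kernel k b t = integral {a..b} p - integral {a..t} p"
    proof (rule eventually_mono)
      fix t assume "t \<in> {a<..<b}"
      then show "delta \<omega> unit_kernel k b t = integral {a..b} p - integral {a..t} p"
        using Henstock_Kurzweil_Integration.integral_combine[of a t b p] p_on delta[of t] by auto
    qed
    then show "((\<lambda>t. delta \<omega> unit_kernel k b t) has_real_derivative - p x) (at x)"
      using d by (subst DERIV_cong_ev[OF refl _ refl, where g = "\<lambda>t. integral {a..b} p - integral {a..t} p"]) auto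
  qed
  have "is_ac_rep a b (right_integral b \<omega> k' f) g"
    using assms(6) unfolding has_ac_rep_def g_def ac_rep_def by (rule someI_ex)
  then have g: "abs_cont_on a b g" and "AE x in lebesgue_on {a..b}. right_integral b \<omega> k' f x = g x"
    by (auto simp: is_ac_rep_def)
  then have g_eq: "AE x in lebesgue. x \<in> {a..b} \<longrightarrow> right_integral b \<omega> k' f x = g x"
    by (simp add: AE_restrict_space_iff)
  \<comment> \<open>Both functions carry the weight: \<open>\<theta>\<close> stands for
    \<open>f\<close> and \<open>\<eta>\<close> for its \<open>k'\<close>-derivative, each times
    \<open>\<omega>\<close>. In \<open>\<eta>\<close> the weight cancels the factor
    \<open>1 / \<omega>\<close> of \<open>right_derivative\<close>, leaving
    \<open>- deriv g\<close>.\<close>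
  define \<theta> where "\<theta> y = indicator {a..b} y * (f y * \<omega> y)" for y
  define \<eta> where "\<eta> y = - (indicator {a..b} y * deriv g y)" for y
  have \<theta>_int: "integrable lebesgue \<theta>"
  proof -
    obtain M where M: "\<omega> \<in> borel_measurable (lebesgue_on {a..b})" "AE x in lebesgue_on {a..b}. \<bar>\<omega> x\<bar> \<le> M"
      using assms(2) by (auto simp: weight_def Linfty_def)
    have "integrable (lebesgue_on {a..b}) (\<lambda>y. f y * \<omega> y)"
    proof (rule Bochner_Integration.integrable_bound)
      show "integrable (lebesgue_on {a..b}) (\<lambda>y. M * f y)" using assms(5) by simp
      show "(\<lambda>y. f y * \<omega> y) \<in> borel_measurable (lebesgue_on {a..b})"
        using assms(5) M(1) by (intro borel_measurable_times) auto
      show "AE y in lebesgue_on {a..b}. norm (f y * \<omega> y) \<le> norm (M * f y)"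
        using M(2)
      proof eventually_elim
        case (elim y)
        then have "\<bar>\<omega> y\<bar> \<le> \<bar>M\<bar>" by linarith
        then show ?case by (simp add: abs_mult mult.commute mult_right_mono)
      qed
    qed
    then show ?thesis by (simp add: integrable_restrict_space \<theta>_def[abs_def])
  qed
  have \<eta>_int: "integrable lebesgue \<eta>"
    unfolding \<eta>_def[abs_def] by (rule integrable_minus[OF abs_cont_on_deriv(1)[OF assms(1) g]])
  have eq: "AE z in lebesgue. a < z \<and> z < b \<longrightarrow>
      (LINT y|lebesgue. \<eta> y * indicator {z<..} y) = (LINT y|lebesgue. K' y z * \<theta> y) - g b"
    using g_eq
  proof (rule eventually_mono, intro impI)
    fix z assume z: "a < z \<and> z < b" and "z \<in> {a..b} \<longrightarrow> right_integral b \<omega> k' f z = g z"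
    then have "(LINT y|lebesgue. K' y z * \<theta> y) = g z"
      using right_integral_eq[of a z b \<omega> k' f] by (simp add: K'_def \<theta>_def)
    moreover have "(LINT y|lebesgue. \<eta> y * indicator {z<..} y) = - (g b - g z)"
      using abs_cont_on_deriv(2)[OF assms(1) g, of z] z by (simp add: \<eta>_def)
    ultimately show "(LINT y|lebesgue. \<eta> y * indicator {z<..} y) = (LINT y|lebesgue. K' y z * \<theta> y) - g b"
      by simp
  qed
  have inv: "AE t in lebesgue. a < t \<and> t < b \<longrightarrow> w t * (LINT y|lebesgue. K y t * \<eta> y) = \<theta> t - g b * p t"
    unfolding p_def
    by (rule conjugate_inversion[OF \<eta>_int _ \<theta>_int _ F G eq]) (auto simp: \<eta>_def \<theta>_def)
  have \<eta>_eq: "indicator {a..b} y * (right_derivative a b \<omega> k' f y * \<omega> y) = \<eta> y" for y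
    using w_pos[of y] by (auto simp: \<eta>_def right_derivative_def g_def[symmetric] w_def extend_weight_def indicator_def)
  have "AE x in lebesgue. x \<noteq> a" "AE x in lebesgue. x \<noteq> b"
    using AE_lborel_singleton[of a] AE_lborel_singleton[of b] by (simp_all add: AE_lebesgue_iff)
  with inv deriv_delta have "AE x in lebesgue. x \<in> {a..b} \<longrightarrow>
    (\<lambda>t. delta \<omega> unit_kernel k b t) differentiable at x \<and>
    right_integral b \<omega> k (right_derivative a b \<omega> k' f) x =
      f x + g b * (1 / \<omega> x * deriv (\<lambda>t. delta \<omega> unit_kernel k b t) x)"
  proof eventually_elim
    case (elim x)
    show ?case
    proof
      assume "x \<in> {a..b}"
      with elim have x: "a < x" "x < b" by auto
      have d: "((\<lambda>t. delta \<omega> unit_kernel k b t) has_real_derivative - p x) (at x)" using elim x by blast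
      have "\<omega> x > 0" and wx: "w x = \<omega> x" using w_pos[of x] x by (auto simp: w_def extend_weight_def)
      have "right_integral b \<omega> k (right_derivative a b \<omega> k' f) x = (LINT y|lebesgue. K y x * \<eta> y)"
        using right_integral_eq[OF x(1)] by (simp add: \<eta>_eq K_def)
      moreover have "\<omega> x * (LINT y|lebesgue. K y x * \<eta> y) = f x * \<omega> x - g b * p x"
        using elim x wx by (simp add: \<theta>_def)
      ultimately have "right_integral b \<omega> k (right_derivative a b \<omega> k' f) x = f x + g b * (1 / \<omega> x * - p x)"
        using \<open>\<omega> x > 0\<close> by (simp add: field_simps)
      with d show "(\<lambda>t. delta \<omega> unit_kernel k b t) differentiable at x \<and>
        right_integral b \<omega> k (right_derivative a b \<omega> k' f) x =
          f x + g b * (1 / \<omega> x * deriv (\<lambda>t. delta \<omega> unit_kernel k b t) x)"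
        by (auto simp: DERIV_imp_deriv real_differentiable_def)
    qed
  qed
  then show ?thesis
    unfolding g_def by (rule AE_restrict_space_iff[THEN iffD2, rotated]) simp
qed

end
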